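(* Let $R>0$ and let $f\in A(R\mathcal{D}_0(\mathbb{C}))$. Let $\theta=\mathrm{id}_{\mathbb{C}}$ be the linear functional on $\mathbb{C}$ with $\theta(1)=1$. The following conditions are equivalent: (1) there exists $g\in A(R\mathcal{D}_0(\mathbb{C}))$ such that $Dg=f$; (2) $(\partial f)_{n;n}(\omega;\omega)=\sigma\big((\partial f)_{n;n}(\omega;\omega)\big)$ for every $n\in\mathbb{N}$ and every $\omega\in R\mathcal{D}_0(\mathbb{C})_n$; (3) $(D\circ D_\theta^* )f=L_\theta f$.
   Context: For $R>0$, $R\mathcal{D}_0(\mathbb{C})=(R\mathcal{D}_0(\mathbb{C})_n)_{n\ge1}$ with $R\mathcal{D}_0(\mathbb{C})_n=\{\omega\in M_n(\mathbb{C}):\|\omega\|<R\}$ (operator norm). $\Omega:=R\mathcal{D}_0(\mathbb{C})$. $A(\Omega)$ is the unital algebra (levelwise operations) of stably matricial analytic $\mathbb{C}$-valued functions on $\Omega$: families $f=(f_n)_{n\ge1}$ of analytic maps $f_n:\Omega_n\to M_n(\mathbb{C})$ such that $f_{m+n}(\omega\oplus\omega')=f_m(\omega)\oplus f_n(\omega')$ and such that $f_n(\omega')=sf_n(\omega)s^{-1}$ whenever $\omega,\omega'\in\Omega_n$, $s\in GL_n(\mathbb{C})$ and $\omega'=s\omega s^{-1}$. $A(\Omega;\Omega)$ is the space of families of analytic maps $f_{m;n}:\Omega_m\times\Omega_n\to M_m(\mathbb{C})\otimes M_n(\mathbb{C})$ which satisfy the same two properties in each variable separately (the other variable being fixed and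 the direct sum and conjugation acting on the corresponding tensor leg). Each $f\in A(\Omega)$ extends uniquely to a family $\widetilde f$ with the same properties on $\widetilde\Omega$, $\widetilde\Omega_n=\bigcup_{s\in GL_n(\mathbb{C})}s\Omega_ns^{-1}$ (similarly for $A(\Omega;\Omega)$); the operators below are defined through this extension and then restricted to $\Omega$. $(a\otimes c)\#b:=abc$, extended linearly in $a\otimes c$; $\sigma(a\otimes b)=b\otimes a$. $\partial:A(\Omega)\to A(\Omega;\Omega)$ is given by $$(\partial f)_{m;n}(\omega;\omega')=\sum_{1\le a,b\le m,\ 1\le c,d\le n}\Big(\tfrac{d}{d\epsilon}f_{m+n}\big(\left[\begin{smallmatrix}\omega&\epsilon e^{(m,n)}_{b,c}\\0&\omega'\end{smallmatrix}\right]\big)\big|_{\epsilon=0}\Big)_{(a,m+d)}e^{(m)}_{a,b}\otimes e^{(n)}_{c,d},$$ where $e^{(m,n)}_{b,c}\in M_{m,n}(\mathbb{C})$ and $e^{(n)}_{c,d}\in M_n(\mathbb{C})$ are matrix units. The cyclic derivative $D:A(\Omega)\to A(\Omega)$ is $(Df)_n(\omega)=\mathrm{mult}\big(\sigma((\partial f)_{n;n}(\omega;\omega))\big)$, with $\mathrm{mult}(a\otimes b)=ab$. $z(\theta)\in A(\Omega)$ is $z(\theta)_n(\omega)=\omega$. $\partial_\theta^*:A(\Omega;\Omega)\to A(\Omega)$ is $(\partial_\theta^*f)_n(\omega)=f_{n;n}(\omega;\omega)\#z(\theta)_n(\omega)$. $D_\theta^*f=f\,z(\theta)$, $N_\theta=\partial_\theta^*\circ\partial$,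 and $L_\theta=N_\theta+\mathrm{id}$. *)

theory Defs
  imports
    "HOL-Analysis.Derivative"
    "HOL-Analysis.L2_Norm"
    "Jordan_Normal_Form.Matrix"
begin

section \<open>Operator norm and matricial discs\<close>

definition vec_l2 :: "complex vec \<Rightarrow> real" where
  "vec_l2 v = L2_set (\<lambda>i. cmod (vec_index v i)) {..<dim_vec v}"

definition opnorm :: "complex mat \<Rightarrow> real" where
  "opnorm A = (SUP v \<in> {v \<in> carrier_vec (dim_col A). vec_l2 v \<le> 1}. vec_l2 (A *\<^sub>v v))"

type_synonym mset_family = "nat \<Rightarrow> complex mat set"
type_synonym mfun = "nat \<Rightarrow> complex mat \<Rightarrow> complex mat"
type_synonym mfun2 = "nat \<Rightarrow> nat \<Rightarrow> complex mat \<Rightarrow> complex mat \<Rightarrow> complex mat"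

definition matricial_disc :: "real \<Rightarrow> mset_family" where
  "matricial_disc R n = {\<omega> \<in> carrier_mat n n. opnorm \<omega> < R}"


section \<open>Stably matricial analytic functions\<close>

definition mat_dsum :: "complex mat \<Rightarrow> complex mat \<Rightarrow> complex mat" where
  "mat_dsum A B = diag_block_mat [A, B]"

definition mat_clinear :: "nat \<Rightarrow> (complex mat \<Rightarrow> complex mat) \<Rightarrow> bool" where
  "mat_clinear n L \<longleftrightarrow>
     L \<in> carrier_mat n n \<rightarrow> carrier_mat n n \<and>
     (\<forall>H\<in>carrier_mat n n. \<forall>K\<in>carrier_mat n n. L (H + K) = L H + L K) \<and>
     (\<forall>c. \<forall>H\<in>carrier_mat n n. L (c \<cdot>\<^sub>m H) = c \<cdot>\<^sub>m L H)"

text \<open>Analytic map from an open set of \<open>n \<times> n\<close> matrices to \<open>n \<times> n\<close> matrices: complex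
  Frechet differentiable at every point (the several-variables form of \<open>holomorphic_on\<close>).
  The type of matrices of all sizes is not a normed space, so the derivative is spelled out.\<close>

definition mat_analytic_on :: "nat \<Rightarrow> (complex mat \<Rightarrow> complex mat) \<Rightarrow> complex mat set \<Rightarrow> bool" where
  "mat_analytic_on n F S \<longleftrightarrow>
     F \<in> S \<rightarrow> carrier_mat n n \<and>
     (\<forall>A\<in>S. \<exists>L. mat_clinear n L \<and>
        (\<forall>e>0. \<exists>d>0. \<forall>H\<in>carrier_mat n n. A + H \<in> S \<longrightarrow> opnorm H < d \<longrightarrow>
           opnorm (F (A + H) - F A - L H) \<le> e * opnorm H))"

text \<open>Families are indexed by all naturals, but only the levels \<open>n \<ge> 1\<close> and the values on
  \<open>\<Omega> n\<close> are meaningful. \<open>similar_mat_wit \<omega>' \<omega> s t\<close> says that \<open>t\<close> is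
  the inverse of \<open>s\<close> and \<open>\<omega>' = s * \<omega> * t\<close>.\<close>

definition A_space :: "mset_family \<Rightarrow> mfun set" where
  "A_space \<Omega> = {f.
     (\<forall>n\<ge>1. mat_analytic_on n (f n) (\<Omega> n)) \<and>
     (\<forall>m\<ge>1. \<forall>n\<ge>1. \<forall>\<omega>\<in>\<Omega> m. \<forall>\<omega>'\<in>\<Omega> n.
        f (m + n) (mat_dsum \<omega> \<omega>') = mat_dsum (f m \<omega>) (f n \<omega>')) \<and>
     (\<forall>n\<ge>1. \<forall>\<omega>\<in>\<Omega> n. \<forall>\<omega>'\<in>\<Omega> n. \<forall>s t.
        similar_mat_wit \<omega>' \<omega> s t \<longrightarrow> f n \<omega>' = s * f n \<omega> * t)}"

definition eq_on_family :: "mset_family \<Rightarrow> mfun \<Rightarrow> mfun \<Rightarrow> bool" where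
  "eq_on_family \<Omega> f g \<longleftrightarrow> (\<forall>n\<ge>1. \<forall>\<omega>\<in>\<Omega> n. f n \<omega> = g n \<omega>)"

text \<open>The extension to the similarity envelope of \<open>\<Omega>\<close>; for \<open>f \<in> A_space \<Omega>\<close> the
  value does not depend on the chosen \<open>\<omega>\<close>, \<open>s\<close>, \<open>t\<close>.\<close>

definition sim_ext :: "mset_family \<Rightarrow> mfun \<Rightarrow> mfun" where
  "sim_ext \<Omega> f n \<omega>' =
     (SOME Y. \<exists>\<omega>\<in>\<Omega> n. \<exists>s t. similar_mat_wit \<omega>' \<omega> s t \<and> Y = s * f n \<omega> * t)"


section \<open>Tensor products of matrix algebras\<close>

text \<open>\<open>M\<^sub>m \<otimes> M\<^sub>n\<close> is realised as the \<open>mn \<times> mn\<close> matrices through the Kronecker product.\<close>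

definition kron :: "complex mat \<Rightarrow> complex mat \<Rightarrow> complex mat" where
  "kron A B = mat (dim_row A * dim_row B) (dim_col A * dim_col B)
     (\<lambda>(r, s). A $$ (r div dim_row B, s div dim_col B) * B $$ (r mod dim_row B, s mod dim_col B))"

definition munit :: "nat \<Rightarrow> nat \<Rightarrow> nat \<Rightarrow> nat \<Rightarrow> complex mat" where
  "munit m n i j = mat m n (\<lambda>(r, s). if r = i \<and> s = j then 1 else 0)"

text \<open>The matrix \<open>\<Sum> t i j k l \<cdot> \<beta> e\<^sub>i\<^sub>j e\<^sub>k\<^sub>l\<close> of size \<open>p \<times> p\<close>, with \<open>e\<^sub>i\<^sub>j\<close> in
  \<open>M\<^sub>m\<close> and \<open>e\<^sub>k\<^sub>l\<close> in \<open>M\<^sub>n\<close>. It is written entrywise because matrices of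
  varying size do not form a monoid type.\<close>

definition munit_sum :: "nat \<Rightarrow> nat \<Rightarrow> nat \<Rightarrow> (complex mat \<Rightarrow> complex mat \<Rightarrow> complex mat) \<Rightarrow>
    (nat \<Rightarrow> nat \<Rightarrow> nat \<Rightarrow> nat \<Rightarrow> complex) \<Rightarrow> complex mat" where
  "munit_sum m n p \<beta> t = mat p p (\<lambda>rs.
     \<Sum>i<m. \<Sum>j<m. \<Sum>k<n. \<Sum>l<n. t i j k l * \<beta> (munit m m i j) (munit n n k l) $$ rs)"

text \<open>Linear extension of \<open>A \<otimes> B \<mapsto> \<beta> A B\<close> from elementary tensors, for bilinear
  \<open>\<beta>\<close>: the entry \<open>(i * n + k, j * n + l)\<close> of \<open>T\<close> is its coefficient at
  \<open>e\<^sub>i\<^sub>j \<otimes> e\<^sub>k\<^sub>l\<close>.\<close>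

definition tensor_lift :: "nat \<Rightarrow> nat \<Rightarrow> nat \<Rightarrow> (complex mat \<Rightarrow> complex mat \<Rightarrow> complex mat) \<Rightarrow>
    complex mat \<Rightarrow> complex mat" where
  "tensor_lift m n p \<beta> T = munit_sum m n p \<beta> (\<lambda>i j k l. T $$ (i * n + k, j * n + l))"

definition tensor_flip :: "nat \<Rightarrow> nat \<Rightarrow> complex mat \<Rightarrow> complex mat" where
  "tensor_flip m n = tensor_lift m n (m * n) (\<lambda>A B. kron B A)"

definition tensor_mult :: "nat \<Rightarrow> complex mat \<Rightarrow> complex mat" where
  "tensor_mult n = tensor_lift n n n (\<lambda>A B. A * B)"

definition tensor_sharp :: "nat \<Rightarrow> complex mat \<Rightarrow> complex mat \<Rightarrow> complex mat" where
  "tensor_sharp n T B = tensor_lift n n n (\<lambda>A C. A * B * C) T"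


text \<open>The lifts act as intended on elementary tensors.\<close>

lemma kron_coeff:
  assumes "A \<in> carrier_mat m m" "B \<in> carrier_mat n n" "i < m" "j < m" "k < n" "l < n"
  shows "kron A B $$ (i * n + k, j * n + l) = A $$ (i, j) * B $$ (k, l)"
proof -
  have *: "a * n + b < m * n" if "a < m" "b < n" for a b :: nat
  proof -
    have "a * n + b < Suc a * n" using that by simp
    also have "\<dots> \<le> m * n" using that by (intro mult_right_mono) auto
    finally show ?thesis .
  qed
  show ?thesis using assms *[of i k] *[of j l] by (simp add: kron_def)
qed

lemma munit_mult_mult:
  assumes "B \<in> carrier_mat n n" "i < n" "j < n" "k < n" "l < n" "r < n" "s < n"
  shows "(munit n n i j * B * munit n n k l) $$ (r, s) =
           (if i = r then if l = s then B $$ (j, k) else 0 else 0)"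
proof -
  have 1: "munit n n i j * B = mat n n (\<lambda>(r, s). if r = i then B $$ (j, s) else 0)"
    using assms
    by (intro eq_matI) (auto simp: munit_def scalar_prod_def if_distrib[of "\<lambda>x. x * _"] 
          sum.delta' cong: if_cong)
  show ?thesis unfolding 1 using assms
    by (auto simp: munit_def scalar_prod_def if_distrib[of "\<lambda>x. _ * x"] cong: if_cong)
qed

lemma kron_munit:
  assumes "r < m * n" "s < m * n"
  shows "kron (munit n n k l) (munit m m i j) $$ (r, s) =
    (if i = r mod m then if j = s mod m then if k = r div m then if l = s div m
     then 1 else 0 else 0 else 0 else 0)"
proof -
  have "m > 0" using assms by (cases m) auto
  then have "r mod m < m" "s mod m < m" by auto
  moreover have "r div m < n" "s div m < n"
    using assms by (auto simp: less_mult_imp_div_less mult.commute)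
  ultimately show ?thesis using assms by (auto simp: kron_def munit_def mult.commute)
qed

lemma tensor_sharp_kron:
  assumes "A \<in> carrier_mat n n" "C \<in> carrier_mat n n" "B \<in> carrier_mat n n"
  shows "tensor_sharp n (kron A C) B = A * B * C"
proof (rule eq_matI, goal_cases)
  case (1 r s)
  then have rs: "r < n" "s < n" using assms by auto
  have "tensor_sharp n (kron A C) B $$ (r, s) =
      (\<Sum>i<n. \<Sum>j<n. \<Sum>k<n. \<Sum>l<n. A $$ (i, j) * C $$ (k, l) *
         (if i = r then if l = s then B $$ (j, k) else 0 else 0))"
    unfolding tensor_sharp_def tensor_lift_def munit_sum_def using rs assms
    by (auto intro!: sum.cong simp: kron_coeff[OF assms(1,2)] munit_mult_mult[OF assms(3)] simp del: index_mult_mat)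
  also have "\<dots> = (\<Sum>i<n. if i = r then \<Sum>j<n. \<Sum>k<n. \<Sum>l<n. if l = s then A $$ (i, j) * C $$ (k, l) * B $$ (j, k) else 0 else 0)"
    by (intro sum.cong refl) (auto simp: mult_delta_right)
  also have "\<dots> = (\<Sum>j<n. \<Sum>k<n. A $$ (r, j) * C $$ (k, s) * B $$ (j, k))"
    using rs by simp
  also have "\<dots> = (A * B * C) $$ (r, s)"
    using rs assms
    by (simp add: scalar_prod_def sum_distrib_right sum_distrib_left atLeast0LessThan mult_ac)
  finally show ?case .
qed (use assms in \<open>auto simp: tensor_sharp_def tensor_lift_def munit_sum_def\<close>)

lemma tensor_mult_kron:
  assumes "A \<in> carrier_mat n n" "C \<in> carrier_mat n n"
  shows "tensor_mult n (kron A C) = A * C"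
proof -
  have [simp]: "munit n n i j * 1\<^sub>m n = munit n n i j" for i j
    by (rule right_mult_one_mat) (auto simp: munit_def)
  have "tensor_mult n T = tensor_sharp n T (1\<^sub>m n)" for T
    by (simp add: tensor_sharp_def tensor_mult_def tensor_lift_def munit_sum_def)
  then show ?thesis using tensor_sharp_kron[OF assms one_carrier_mat] assms by simp
qed

lemma tensor_flip_kron:
  assumes "A \<in> carrier_mat m m" "B \<in> carrier_mat n n"
  shows "tensor_flip m n (kron A B) = kron B A"
proof (rule eq_matI, goal_cases)
  case (1 r s)
  then have rs: "r < m * n" "s < m * n" using assms by (auto simp: kron_def mult.commute)
  then have "m > 0" by (cases m) auto
  then have m: "r mod m < m" "s mod m < m" by auto
  have n: "r div m < n" "s div m < n"
    using rs by (auto simp: less_mult_imp_div_less mult.commute)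
  have "tensor_flip m n (kron A B) $$ (r, s) =
      (\<Sum>i<m. \<Sum>j<m. \<Sum>k<n. \<Sum>l<n. A $$ (i, j) * B $$ (k, l) *
       (if i = r mod m then if j = s mod m then if k = r div m then if l = s div m
        then 1 else 0 else 0 else 0 else 0))"
    unfolding tensor_flip_def tensor_lift_def munit_sum_def using rs assms
    by (auto intro!: sum.cong simp: kron_coeff[OF assms] kron_munit)
  also have "\<dots> = (\<Sum>i<m. \<Sum>j<m. \<Sum>k<n. \<Sum>l<n. if l = s div m then if k = r div m then
      if j = s mod m then if i = r mod m then A $$ (i, j) * B $$ (k, l) else 0 else 0 else 0 else 0)"
    by (intro sum.cong refl) auto
  also have "\<dots> = A $$ (r mod m, s mod m) * B $$ (r div m, s div m)"
    using m n by simp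
  also have "\<dots> = kron B A $$ (r, s)"
    using assms rs by (simp add: kron_def mult.commute)
  finally show ?case .
qed (use assms in \<open>auto simp: tensor_flip_def tensor_lift_def munit_sum_def kron_def mult.commute\<close>)


section \<open>The operators\<close>

text \<open>Indices start at 0, so row \<open>a\<close> and column \<open>m + d\<close> below address the upper
  right block.\<close>

definition diff_quot :: "mset_family \<Rightarrow> mfun \<Rightarrow> mfun2" where
  "diff_quot \<Omega> f m n \<omega> \<omega>' = munit_sum m n (m * n) kron (\<lambda>a b c d.
     deriv (\<lambda>\<epsilon>. sim_ext \<Omega> f (m + n)
       (four_block_mat \<omega> (\<epsilon> \<cdot>\<^sub>m munit m n b c) (0\<^sub>m n m) \<omega>') $$ (a, m + d)) 0)"

definition cyc_deriv :: "mset_family \<Rightarrow> mfun \<Rightarrow> mfun" where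
  "cyc_deriv \<Omega> f n \<omega> = tensor_mult n (tensor_flip n n (diff_quot \<Omega> f n n \<omega> \<omega>))"

text \<open>The coordinate function \<open>z(\<theta>)\<close> for \<open>\<theta> = id\<close> on the complex numbers. The operators
  indexed by \<open>\<theta>\<close> below are for this \<open>\<theta>\<close>.\<close>

definition z_theta :: mfun where
  "z_theta n \<omega> = \<omega>"

definition diff_quot_star :: "mfun2 \<Rightarrow> mfun" where
  "diff_quot_star F n \<omega> = tensor_sharp n (F n n \<omega> \<omega>) (z_theta n \<omega>)"

definition cyc_deriv_star :: "mfun \<Rightarrow> mfun" where
  "cyc_deriv_star f n \<omega> = f n \<omega> * z_theta n \<omega>"

definition N_theta :: "mset_family \<Rightarrow> mfun \<Rightarrow> mfun" where
  "N_theta \<Omega> f = diff_quot_star (diff_quot \<Omega> f)"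

definition L_theta :: "mset_family \<Rightarrow> mfun \<Rightarrow> mfun" where
  "L_theta \<Omega> f n \<omega> = N_theta \<Omega> f n \<omega> + f n \<omega>"

end

theory Submission
  imports
    Defs
    "HOL-Complex_Analysis.Cauchy_Integral_Formula"
    "Jordan_Normal_Form.Jordan_Normal_Form_Existence"
begin

text \<open>
  Over the scalars \<open>\<complex>\<close> each of the three conditions holds for every \<open>f\<close>, and this is how the
  equivalences are proved. The reason is that every stably matricial analytic function on the
  disc of radius \<open>R\<close> is a power series \<open>f\<^sub>n(A) = \<Sum> a\<^sub>k A\<^sup>k\<close> with scalar coefficients
  (\<open>A_space_eq_mat_series\<close>). At level one \<open>f\<close> is a holomorphic function on a disc and has a Taylor
  series; compatibility with direct sums gives the formula on diagonal matrices, similarity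
  invariance gives it on diagonalizable ones, and continuity on all matrices in the disc.
  Conversely every such series belongs to the algebra (\<open>mat_series_in_A_space\<close>).

  For power series the operators are explicit. The monomial \<open>z\<^sup>k\<close> has difference quotient
  \<open>\<Sum> A\<^sup>p \<otimes> B\<^sup>q\<close> over \<open>p + q = k - 1\<close>, as one reads off from the powers of an upper triangular block matrix.
  At \<open>A = B\<close> this is invariant under the flip (\<open>diff_quot_flip_invariant\<close>), its image under flip and
  multiplication is \<open>k A\<^sup>k\<^sup>-\<^sup>1\<close> (\<open>cyc_deriv_series\<close>), and contracting it with the coordinate function gives
  \<open>k A\<^sup>k\<close> (\<open>N_theta_series\<close>). So the cyclic derivative is the usual derivative, term by term integration
  provides an antiderivative of \<open>f\<close>, and the third condition is the product rule \<open>(z f)' = z f' + f\<close>.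
\<close>

section \<open>The operator norm\<close>

lemma vec_l2_nonneg [simp]: "0 \<le> vec_l2 v"
  by (simp add: vec_l2_def L2_set_nonneg)

lemma vec_l2_smult: "vec_l2 (c \<cdot>\<^sub>v v) = cmod c * vec_l2 v"
  unfolding vec_l2_def L2_set_right_distrib[OF norm_ge_zero]
  by (auto intro!: L2_set_cong simp: norm_mult)

lemma vec_l2_add_le:
  assumes "v \<in> carrier_vec n" "w \<in> carrier_vec n"
  shows "vec_l2 (v + w) \<le> vec_l2 v + vec_l2 w"
proof -
  have "vec_l2 (v + w) \<le> L2_set (\<lambda>i. cmod (vec_index v i) + cmod (vec_index w i)) {..<n}"
    unfolding vec_l2_def using assms by (auto intro!: L2_set_mono norm_triangle_ineq)
  also have "\<dots> \<le> vec_l2 v + vec_l2 w"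
    unfolding vec_l2_def using assms by (auto intro!: L2_set_triangle_ineq)
  finally show ?thesis .
qed

lemma norm_vec_index_le_l2: "i < dim_vec v \<Longrightarrow> cmod (vec_index v i) \<le> vec_l2 v"
  unfolding vec_l2_def by (rule member_le_L2_set) auto

lemma vec_l2_le_sum: "vec_l2 v \<le> (\<Sum>i<dim_vec v. cmod (vec_index v i))"
  unfolding vec_l2_def by (rule L2_set_le_sum) auto

lemma vec_l2_eq_0_iff: "vec_l2 v = 0 \<longleftrightarrow> v = 0\<^sub>v (dim_vec v)"
  unfolding vec_l2_def
proof (subst L2_set_eq_0_iff)
  show "(\<forall>i\<in>{..<dim_vec v}. cmod (vec_index v i) = 0) = (v = 0\<^sub>v (dim_vec v))"
    by (metis eq_vecI index_zero_vec lessThan_iff norm_eq_zero)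
qed auto

lemma vec_l2_unit_vec: "i < n \<Longrightarrow> vec_l2 (unit_vec n i) = 1"
proof -
  assume "i < n"
  then have "(\<Sum>k<n. (cmod (if k = i then 1 else 0))\<^sup>2) = (\<Sum>k<n. if k = i then 1 else 0)"
    by (intro sum.cong) auto
  then show ?thesis
    unfolding vec_l2_def L2_set_def using \<open>i < n\<close> by (simp add: unit_vec_def)
qed

lemma vec_l2_append: "(vec_l2 (v @\<^sub>v w))\<^sup>2 = (vec_l2 v)\<^sup>2 + (vec_l2 w)\<^sup>2"
proof -
  have *: "(\<Sum>i<m+n. g i) = (\<Sum>i<m. g i) + (\<Sum>i<n. g (m + i))" for m n and g :: "nat \<Rightarrow> real"
    by (induction n) auto
  show ?thesis
    unfolding vec_l2_def L2_set_def by (simp add: sum_nonneg *)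
qed

text \<open>The sum of the moduli of the entries bounds the operator norm. In particular the
  supremum defining \<open>opnorm\<close> is over a bounded set.\<close>
lemma vec_l2_mult_le_sum:
  assumes v: "v \<in> carrier_vec (dim_col A)" "vec_l2 v \<le> 1"
  shows "vec_l2 (A *\<^sub>v v) \<le> (\<Sum>i<dim_row A. \<Sum>j<dim_col A. cmod (A $$ (i, j)))"
proof -
  have "cmod (vec_index (A *\<^sub>v v) i) \<le> (\<Sum>j<dim_col A. cmod (A $$ (i, j)))" if i: "i < dim_row A" for i
  proof -
    have "vec_index (A *\<^sub>v v) i = (\<Sum>j<dim_col A. A $$ (i, j) * vec_index v j)"
      using i v by (simp add: scalar_prod_def atLeast0LessThan)
    also have "cmod \<dots> \<le> (\<Sum>j<dim_col A. cmod (A $$ (i, j)))"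
    proof (rule sum_norm_le)
      fix j assume "j \<in> {..<dim_col A}"
      then have "cmod (vec_index v j) \<le> 1"
        using norm_vec_index_le_l2[of j v] v by auto
      then show "cmod (A $$ (i, j) * vec_index v j) \<le> cmod (A $$ (i, j))"
        by (simp add: norm_mult mult_left_le)
    qed
    finally show ?thesis .
  qed
  then show ?thesis
    by (intro order_trans[OF vec_l2_le_sum]) (auto intro!: sum_mono)
qed

lemma bdd_above_opnorm:
  "bdd_above ((\<lambda>v. vec_l2 (A *\<^sub>v v)) ` {v \<in> carrier_vec (dim_col A). vec_l2 v \<le> 1})"
  by (rule bdd_aboveI2[where M = "\<Sum>i<dim_row A. \<Sum>j<dim_col A. cmod (A $$ (i, j))"])
     (use vec_l2_mult_le_sum in auto)

lemma opnorm_leI: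
  assumes "\<And>v. v \<in> carrier_vec (dim_col A) \<Longrightarrow> vec_l2 v \<le> 1 \<Longrightarrow> vec_l2 (A *\<^sub>v v) \<le> c"
  shows "opnorm A \<le> c"
  unfolding opnorm_def
proof (rule cSUP_least)
  have "vec_l2 (0\<^sub>v (dim_col A)) = 0" by (simp add: vec_l2_eq_0_iff)
  then have "0\<^sub>v (dim_col A) \<in> {v \<in> carrier_vec (dim_col A). vec_l2 v \<le> 1}" by simp
  then show "{v \<in> carrier_vec (dim_col A). vec_l2 v \<le> 1} \<noteq> {}" by blast
qed (use assms in auto)

lemma vec_l2_mult_le_opnorm:
  assumes "v \<in> carrier_vec (dim_col A)" "vec_l2 v \<le> 1"
  shows "vec_l2 (A *\<^sub>v v) \<le> opnorm A"
  unfolding opnorm_def by (rule cSUP_upper[OF _ bdd_above_opnorm]) (use assms in auto)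

lemma opnorm_nonneg [simp]: "0 \<le> opnorm A"
proof -
  have "vec_l2 (0\<^sub>v (dim_col A)) = 0" by (simp add: vec_l2_eq_0_iff)
  then show ?thesis
    using order_trans[OF vec_l2_nonneg vec_l2_mult_le_opnorm[of "0\<^sub>v (dim_col A)" A]] by simp
qed

lemma vec_l2_mult_le:
  assumes v: "v \<in> carrier_vec (dim_col A)"
  shows "vec_l2 (A *\<^sub>v v) \<le> opnorm A * vec_l2 v"
proof (cases "vec_l2 v = 0")
  case True
  then have "v = 0\<^sub>v (dim_col A)" using v by (simp add: vec_l2_eq_0_iff)
  then have "A *\<^sub>v v = 0\<^sub>v (dim_row A)" by auto
  then show ?thesis using True vec_l2_eq_0_iff[of "A *\<^sub>v v"] by simp
next
  case False
  then have pos: "vec_l2 v > 0" using vec_l2_nonneg[of v] by linarith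
  define c where "c = complex_of_real (1 / vec_l2 v)"
  have "vec_l2 (A *\<^sub>v (c \<cdot>\<^sub>v v)) \<le> opnorm A"
    by (rule vec_l2_mult_le_opnorm) (use v pos in \<open>auto simp: vec_l2_smult c_def norm_divide\<close>)
  moreover have "A *\<^sub>v (c \<cdot>\<^sub>v v) = c \<cdot>\<^sub>v (A *\<^sub>v v)" using v by (intro mult_mat_vec[of A "dim_row A" "dim_col A"]) auto
  ultimately show ?thesis using pos by (simp add: vec_l2_smult c_def norm_divide field_simps)
qed

lemma norm_entry_le_opnorm:
  assumes "i < dim_row A" "j < dim_col A"
  shows "cmod (A $$ (i, j)) \<le> opnorm A"
proof -
  define w where "w = A *\<^sub>v unit_vec (dim_col A) j"
  have "w = col A j"
    unfolding w_def using assms by (intro eq_vecI) auto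
  then have "vec_index w i = A $$ (i, j)" "dim_vec w = dim_row A"
    using assms by auto
  then have "cmod (A $$ (i, j)) \<le> vec_l2 w"
    using norm_vec_index_le_l2[of i w] assms(1) by metis
  also have "\<dots> \<le> opnorm A"
    unfolding w_def
    by (rule vec_l2_mult_le_opnorm) (use assms in \<open>simp_all add: vec_l2_unit_vec\<close>)
  finally show ?thesis .
qed

lemma opnorm_le_sum: "opnorm A \<le> (\<Sum>i<dim_row A. \<Sum>j<dim_col A. cmod (A $$ (i, j)))"
  by (rule opnorm_leI) (rule vec_l2_mult_le_sum)

lemma opnorm_add_le:
  assumes "A \<in> carrier_mat m n" "B \<in> carrier_mat m n"
  shows "opnorm (A + B) \<le> opnorm A + opnorm B"
proof (rule opnorm_leI)
  fix v assume "v \<in> carrier_vec (dim_col (A + B))" and v1: "vec_l2 v \<le> 1"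
  then have v: "v \<in> carrier_vec n" using assms by auto
  have "vec_l2 ((A + B) *\<^sub>v v) \<le> vec_l2 (A *\<^sub>v v) + vec_l2 (B *\<^sub>v v)"
    unfolding add_mult_distrib_mat_vec[OF assms v]
    by (rule vec_l2_add_le[of _ m]) (use assms v in auto)
  also have "\<dots> \<le> opnorm A + opnorm B"
    using vec_l2_mult_le_opnorm[of v A] vec_l2_mult_le_opnorm[of v B] assms v v1
    by (intro add_mono) auto
  finally show "vec_l2 ((A + B) *\<^sub>v v) \<le> opnorm A + opnorm B" .
qed

lemma opnorm_mult_le:
  assumes A: "A \<in> carrier_mat m n" and B: "B \<in> carrier_mat n p"
  shows "opnorm (A * B) \<le> opnorm A * opnorm B"
proof (rule opnorm_leI)
  fix v assume "v \<in> carrier_vec (dim_col (A * B))" and v1: "vec_l2 v \<le> 1"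
  then have v: "v \<in> carrier_vec p" using assms by auto
  have "vec_l2 ((A * B) *\<^sub>v v) = vec_l2 (A *\<^sub>v (B *\<^sub>v v))"
    using assoc_mult_mat_vec[OF A B v] by simp
  also have "\<dots> \<le> opnorm A * vec_l2 (B *\<^sub>v v)"
    by (rule vec_l2_mult_le) (use A B v in auto)
  also have "\<dots> \<le> opnorm A * opnorm B"
    by (intro mult_left_mono vec_l2_mult_le_opnorm) (use B v v1 in auto)
  finally show "vec_l2 ((A * B) *\<^sub>v v) \<le> opnorm A * opnorm B" .
qed

lemma opnorm_smult_le: "opnorm (c \<cdot>\<^sub>m A) \<le> cmod c * opnorm A"
proof (rule opnorm_leI)
  fix v assume "v \<in> carrier_vec (dim_col (c \<cdot>\<^sub>m A))" and v1: "vec_l2 v \<le> 1"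
  then have v: "v \<in> carrier_vec (dim_col A)" by simp
  have "(c \<cdot>\<^sub>m A) *\<^sub>v v = c \<cdot>\<^sub>v (A *\<^sub>v v)"
    using v by (intro eq_vecI) (auto simp: scalar_prod_def sum_distrib_left mult.assoc)
  then show "vec_l2 ((c \<cdot>\<^sub>m A) *\<^sub>v v) \<le> cmod c * opnorm A"
    by (simp only: vec_l2_smult mult_left_mono[OF vec_l2_mult_le_opnorm[OF v v1] norm_ge_zero])
qed

lemma opnorm_one_le: "opnorm (1\<^sub>m n) \<le> 1"
  by (rule opnorm_leI) auto

lemma opnorm_pow_le:
  assumes "A \<in> carrier_mat n n"
  shows "opnorm (A ^\<^sub>m k) \<le> opnorm A ^ k"
proof (induction k)
  case 0
  then show ?case using opnorm_one_le by simp
next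
  case (Suc k)
  have "opnorm (A ^\<^sub>m Suc k) \<le> opnorm (A ^\<^sub>m k) * opnorm A"
    using opnorm_mult_le[of "A ^\<^sub>m k" n n A n] assms by simp
  also have "\<dots> \<le> opnorm A ^ k * opnorm A" using Suc by (intro mult_right_mono) auto
  finally show ?case by (simp add: mult.commute)
qed

lemma mat_dsum_four_block:
  "mat_dsum A B = four_block_mat A (0\<^sub>m (dim_row A) (dim_col B)) (0\<^sub>m (dim_row B) (dim_col A)) B"
  unfolding mat_dsum_def by (subst diag_block_mat.simps, subst diag_block_mat_singleton) (simp add: Let_def)

lemma mat_dsum_carrier [simp]:
  "A \<in> carrier_mat m m \<Longrightarrow> B \<in> carrier_mat n n \<Longrightarrow> mat_dsum A B \<in> carrier_mat (m + n) (m + n)"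
  by (auto simp: mat_dsum_four_block)

lemma opnorm_dsum_le:
  assumes A: "A \<in> carrier_mat m m" and B: "B \<in> carrier_mat n n"
  shows "opnorm (mat_dsum A B) \<le> max (opnorm A) (opnorm B)"
proof (rule opnorm_leI)
  fix v assume "v \<in> carrier_vec (dim_col (mat_dsum A B))" and v1: "vec_l2 v \<le> 1"
  then have v: "v \<in> carrier_vec (m + n)" using mat_dsum_carrier[OF A B] by auto
  define M where "M = max (opnorm A) (opnorm B)"
  have M: "M \<ge> 0" "opnorm A \<le> M" "opnorm B \<le> M" by (auto simp: M_def max.coboundedI1)
  define x where "x = vec_first v m"
  define y where "y = vec_last v n"
  have xy: "x \<in> carrier_vec m" "y \<in> carrier_vec n" "v = x @\<^sub>v y"
    using v unfolding x_def y_def by auto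
  have "mat_dsum A B *\<^sub>v v = (A *\<^sub>v x) @\<^sub>v (B *\<^sub>v y)"
    unfolding mat_dsum_four_block xy(3) using A B xy
    by (subst four_block_mat_mult_vec[OF A _ _ B xy(1,2)]) auto
  then have 1: "(vec_l2 (mat_dsum A B *\<^sub>v v))\<^sup>2 = (vec_l2 (A *\<^sub>v x))\<^sup>2 + (vec_l2 (B *\<^sub>v y))\<^sup>2"
    by (simp add: vec_l2_append)
  have "vec_l2 (A *\<^sub>v x) \<le> opnorm A * vec_l2 x" "vec_l2 (B *\<^sub>v y) \<le> opnorm B * vec_l2 y"
    using A B xy by (auto intro!: vec_l2_mult_le)
  moreover have "opnorm A * vec_l2 x \<le> M * vec_l2 x" "opnorm B * vec_l2 y \<le> M * vec_l2 y"
    using M by (auto intro!: mult_right_mono)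
  ultimately have 2: "vec_l2 (A *\<^sub>v x) \<le> M * vec_l2 x" "vec_l2 (B *\<^sub>v y) \<le> M * vec_l2 y"
    by linarith+
  have 3: "(vec_l2 (A *\<^sub>v x))\<^sup>2 \<le> (M * vec_l2 x)\<^sup>2" "(vec_l2 (B *\<^sub>v y))\<^sup>2 \<le> (M * vec_l2 y)\<^sup>2"
    using 2 by (auto intro!: power_mono)
  have 4: "(M * vec_l2 x)\<^sup>2 + (M * vec_l2 y)\<^sup>2 = M\<^sup>2 * (vec_l2 v)\<^sup>2"
    unfolding xy(3) vec_l2_append by (simp add: algebra_simps)
  have 5: "M\<^sup>2 * (vec_l2 v)\<^sup>2 \<le> M\<^sup>2"
    using v1 by (intro mult_left_le) (auto simp: power_le_one)
  have "(vec_l2 (mat_dsum A B *\<^sub>v v))\<^sup>2 \<le> M\<^sup>2"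
    using 1 3 4 5 by linarith
  then have "vec_l2 (mat_dsum A B *\<^sub>v v) \<le> M"
    using M(1) by (rule power2_le_imp_le)
  then show "vec_l2 (mat_dsum A B *\<^sub>v v) \<le> max (opnorm A) (opnorm B)"
    by (simp add: M_def)
qed

lemma norm_eigenvalue_le_opnorm:
  assumes "A \<in> carrier_mat n n" "eigenvalue A z"
  shows "cmod z \<le> opnorm A"
proof -
  from assms obtain v where v: "v \<in> carrier_vec n" "v \<noteq> 0\<^sub>v n" "A *\<^sub>v v = z \<cdot>\<^sub>v v"
    unfolding eigenvalue_def eigenvector_def by auto
  have "cmod z * vec_l2 v \<le> opnorm A * vec_l2 v"
    using vec_l2_mult_le[of v A] v assms by (simp add: vec_l2_smult)
  moreover have "vec_l2 v > 0" using v vec_l2_eq_0_iff[of v] vec_l2_nonneg[of v] by (auto simp: less_le)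
  ultimately show ?thesis by simp
qed

section \<open>Matrix power series\<close>

text \<open>The coefficients of a power series that converges on the disc of radius \<open>R\<close>,
  expressed by absolute convergence at every radius below \<open>R\<close>.\<close>
definition power_summable :: "real \<Rightarrow> (nat \<Rightarrow> complex) \<Rightarrow> bool" where
  "power_summable R a \<longleftrightarrow> (\<forall>r. 0 \<le> r \<longrightarrow> r < R \<longrightarrow> summable (\<lambda>k. cmod (a k) * r ^ k))"

lemma power_summableD: "power_summable R a \<Longrightarrow> 0 \<le> r \<Longrightarrow> r < R \<Longrightarrow> summable (\<lambda>k. cmod (a k) * r ^ k)"
  by (simp add: power_summable_def)

lemma power_summable_of_nat_mult:
  assumes "power_summable R a"
  shows "power_summable R (\<lambda>k. of_nat k * a k)"
  unfolding power_summable_def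
proof (intro allI impI)
  fix r :: real assume r: "0 \<le> r" "r < R"
  define c where "c = (\<lambda>k. cmod (a k))"
  have "summable (\<lambda>n. diffs c n * r ^ n)"
  proof (rule termdiff_converges[of r R])
    show "norm r < R" using r by simp
    fix x :: real assume x: "norm x < R"
    show "summable (\<lambda>n. c n * x ^ n)"
      by (rule summable_norm_cancel)
         (use power_summableD[OF assms, of "\<bar>x\<bar>"] x in \<open>simp add: c_def abs_mult power_abs\<close>)
  qed
  then have "summable (\<lambda>n. r * (diffs c n * r ^ n))"
    by (rule summable_mult)
  moreover have "(\<lambda>n. r * (diffs c n * r ^ n)) = (\<lambda>n. cmod (of_nat (Suc n) * a (Suc n)) * r ^ Suc n)"
    by (rule ext) (simp only: diffs_def c_def norm_mult norm_of_nat power_Suc mult_ac)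
  ultimately have "summable (\<lambda>n. cmod (of_nat (Suc n) * a (Suc n)) * r ^ Suc n)"
    by simp
  then show "summable (\<lambda>k. cmod (of_nat k * a k) * r ^ k)"
    by (subst (asm) summable_Suc_iff)
qed

lemma power_summable_shift:
  assumes "power_summable R a" "\<And>k. cmod (b (Suc k)) \<le> cmod (a k)"
  shows "power_summable R b"
  unfolding power_summable_def
proof (intro allI impI)
  fix r :: real assume r: "0 \<le> r" "r < R"
  have "summable (\<lambda>k. r * (cmod (a k) * r ^ k))"
    by (intro summable_mult power_summableD[OF assms(1)] r)
  then have "summable (\<lambda>k. cmod (b (Suc k)) * r ^ Suc k)"
  proof (rule summable_comparison_test'[where N = 0])
    fix k
    have "cmod (b (Suc k)) * (r * r ^ k) \<le> cmod (a k) * (r * r ^ k)"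
      using assms(2) r by (intro mult_right_mono) auto
    then show "norm (cmod (b (Suc k)) * r ^ Suc k) \<le> r * (cmod (a k) * r ^ k)"
      using r by (simp add: abs_mult mult_ac)
  qed
  then show "summable (\<lambda>k. cmod (b k) * r ^ k)"
    by (subst (asm) summable_Suc_iff)
qed

lemma norm_pow_entry_le:
  assumes "A \<in> carrier_mat n n" "opnorm A \<le> r" "i < n" "j < n"
  shows "cmod ((A ^\<^sub>m k) $$ (i, j)) \<le> r ^ k"
proof -
  have "cmod ((A ^\<^sub>m k) $$ (i, j)) \<le> opnorm (A ^\<^sub>m k)"
    using assms by (intro norm_entry_le_opnorm) auto
  also have "\<dots> \<le> opnorm A ^ k" by (rule opnorm_pow_le) fact
  also have "\<dots> \<le> r ^ k" using assms by (intro power_mono) auto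
  finally show ?thesis .
qed

text \<open>The matrix power series \<open>\<Sum> a\<^sub>k A\<^sup>k\<close> at level \<open>n\<close>, summed entry by entry.\<close>
definition mat_series :: "(nat \<Rightarrow> complex) \<Rightarrow> mfun" where
  "mat_series a n A = mat n n (\<lambda>ij. \<Sum>k. a k * (A ^\<^sub>m k) $$ ij)"

lemma mat_series_carrier [simp]: "mat_series a n A \<in> carrier_mat n n"
  "dim_row (mat_series a n A) = n" "dim_col (mat_series a n A) = n"
  by (auto simp: mat_series_def)

lemma mat_series_sums:
  assumes "power_summable R a" "A \<in> matricial_disc R n" "i < n" "j < n"
  shows "(\<lambda>k. a k * (A ^\<^sub>m k) $$ (i, j)) sums (mat_series a n A $$ (i, j))"
proof -
  have A: "A \<in> carrier_mat n n" "opnorm A < R" using assms by (auto simp: matricial_disc_def)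
  have "summable (\<lambda>k. a k * (A ^\<^sub>m k) $$ (i, j))"
    by (rule summable_comparison_test'[OF power_summableD[OF assms(1) opnorm_nonneg A(2)], of 0])
       (auto simp: norm_mult intro!: mult_left_mono norm_pow_entry_le assms A)
  then show ?thesis using assms by (simp add: mat_series_def summable_sums)
qed

lemma index_mult_mat_sum:
  assumes "A \<in> carrier_mat m n" "B \<in> carrier_mat n p" "i < m" "j < p"
  shows "(A * B) $$ (i, j) = (\<Sum>x<n. A $$ (i, x) * B $$ (x, j))"
  using assms by (simp add: scalar_prod_def atLeast0LessThan)

lemma index_triple_mult_mat:
  assumes "S \<in> carrier_mat n n" "M \<in> carrier_mat n n" "T \<in> carrier_mat n n" "i < n" "j < n"
  shows "(S * M * T) $$ (i, j) = (\<Sum>x<n. (\<Sum>y<n. S $$ (i, y) * M $$ (y, x)) * T $$ (x, j))"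
  by (subst index_mult_mat_sum[OF mult_carrier_mat[OF assms(1,2)] assms(3,4,5)])
     (simp add: index_mult_mat_sum[OF assms(1,2)] assms(4) del: index_mult_mat(1))

lemma mat_series_similar:
  assumes a: "power_summable R a" and w: "w \<in> matricial_disc R n" and sim: "similar_mat_wit w' w s t"
  shows "mat_series a n w' = s * mat_series a n w * t"
proof (rule eq_matI)
  have wc: "w \<in> carrier_mat n n" using w by (auto simp: matricial_disc_def)
  then have "w' \<in> carrier_mat n n"
    using similar_mat_witD[OF refl sim] by (metis carrier_matD(1))
  note sd = similar_mat_witD2[OF this sim]
  show "dim_row (mat_series a n w') = dim_row (s * mat_series a n w * t)"
    "dim_col (mat_series a n w') = dim_col (s * mat_series a n w * t)"
    using sd by auto
  fix i j assume "i < dim_row (s * mat_series a n w * t)" "j < dim_col (s * mat_series a n w * t)"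
  then have ij: "i < n" "j < n" using sd by auto
  have "(\<lambda>k. a k * (w' ^\<^sub>m k) $$ (i, j)) sums ((s * mat_series a n w * t) $$ (i, j))"
  proof -
    have "(\<lambda>k. \<Sum>x<n. (\<Sum>y<n. s $$ (i, y) * (a k * (w ^\<^sub>m k) $$ (y, x))) * t $$ (x, j)) sums
          (\<Sum>x<n. (\<Sum>y<n. s $$ (i, y) * mat_series a n w $$ (y, x)) * t $$ (x, j))"
      by (intro sums_sum sums_mult2 sums_mult mat_series_sums[OF a w]) auto
    also have "(\<Sum>x<n. (\<Sum>y<n. s $$ (i, y) * mat_series a n w $$ (y, x)) * t $$ (x, j)) =
        (s * mat_series a n w * t) $$ (i, j)"
      by (rule index_triple_mult_mat[symmetric]) (use sd ij in auto)
    also have "(\<lambda>k. \<Sum>x<n. (\<Sum>y<n. s $$ (i, y) * (a k * (w ^\<^sub>m k) $$ (y, x))) * t $$ (x, j)) =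
        (\<lambda>k. a k * (w' ^\<^sub>m k) $$ (i, j))"
    proof
      fix k
      have "(w' ^\<^sub>m k) $$ (i, j) = (s * w ^\<^sub>m k * t) $$ (i, j)"
        using similar_mat_wit_pow_id[OF sim] by simp
      also have "\<dots> = (\<Sum>x<n. (\<Sum>y<n. s $$ (i, y) * (w ^\<^sub>m k) $$ (y, x)) * t $$ (x, j))"
        by (rule index_triple_mult_mat) (use sd ij wc in auto)
      finally show "(\<Sum>x<n. (\<Sum>y<n. s $$ (i, y) * (a k * (w ^\<^sub>m k) $$ (y, x))) * t $$ (x, j)) =
          a k * (w' ^\<^sub>m k) $$ (i, j)"
        by (simp add: sum_distrib_left sum_distrib_right mult_ac)
    qed
    finally show ?thesis .
  qed
  then show "mat_series a n w' $$ (i, j) = (s * mat_series a n w * t) $$ (i, j)"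
    using ij by (simp add: mat_series_def[of a n w'] sums_iff)
qed

lemma mat_dsum_pow:
  assumes "A \<in> carrier_mat m m" "B \<in> carrier_mat n n"
  shows "mat_dsum A B ^\<^sub>m k = mat_dsum (A ^\<^sub>m k) (B ^\<^sub>m k)"
  unfolding mat_dsum_def by (subst diag_block_pow_mat) (use assms in auto)

lemma index_mat_dsum:
  assumes "A \<in> carrier_mat m m" "B \<in> carrier_mat n n" "i < m + n" "j < m + n"
  shows "mat_dsum A B $$ (i, j) =
    (if i < m then if j < m then A $$ (i, j) else 0
     else if j < m then 0 else B $$ (i - m, j - m))"
  using assms by (auto simp: mat_dsum_four_block)

lemma mat_series_dsum:
  assumes "A \<in> carrier_mat m m" "B \<in> carrier_mat n n"
  shows "mat_series a (m + n) (mat_dsum A B) = mat_dsum (mat_series a m A) (mat_series a n B)"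
proof (rule eq_matI)
  fix i j assume "i < dim_row (mat_dsum (mat_series a m A) (mat_series a n B))"
    "j < dim_col (mat_dsum (mat_series a m A) (mat_series a n B))"
  then have ij: "i < m + n" "j < m + n" by (auto simp: mat_dsum_four_block)
  then show "mat_series a (m + n) (mat_dsum A B) $$ (i, j) =
      mat_dsum (mat_series a m A) (mat_series a n B) $$ (i, j)"
    unfolding index_mat_dsum[OF mat_series_carrier(1) mat_series_carrier(1) ij]
    by (simp add: mat_series_def mat_dsum_pow[OF assms] 
        index_mat_dsum[OF pow_carrier_mat[OF assms(1)] pow_carrier_mat[OF assms(2)] ij])
qed (auto simp: mat_dsum_four_block)

section \<open>Divided differences of matrix powers\<close>

text \<open>\<open>pow_divdiff A E B k\<close> is \<open>\<Sum> A\<^sup>p E B\<^sup>q\<close> over \<open>p + q = k - 1\<close>, for a rectangular \<open>E\<close>. With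
  \<open>B = A\<close> it is the derivative of the \<open>k\<close>-th power at \<open>A\<close> in the direction \<open>E\<close>; in general it is the
  corner of the \<open>k\<close>-th power of an upper triangular block matrix.\<close>
primrec pow_divdiff :: "complex mat \<Rightarrow> complex mat \<Rightarrow> complex mat \<Rightarrow> nat \<Rightarrow> complex mat" where
  "pow_divdiff A E B 0 = 0\<^sub>m (dim_row A) (dim_col B)"
| "pow_divdiff A E B (Suc k) = pow_divdiff A E B k * B + A ^\<^sub>m k * E"

lemma pow_divdiff_carrier [simp]:
  assumes "A \<in> carrier_mat m m" "E \<in> carrier_mat m n" "B \<in> carrier_mat n n"
  shows "pow_divdiff A E B k \<in> carrier_mat m n"
  by (induction k) (use assms in auto)

lemma munit_carrier [simp]: "munit m n i j \<in> carrier_mat m n"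
  by (simp add: munit_def)

lemma pow_divdiff_munit:
  assumes A: "A \<in> carrier_mat m m" and B: "B \<in> carrier_mat n n"
    and i: "a < m" "b < m" "c < n" "d < n"
  shows "pow_divdiff A (munit m n b c) B k $$ (a, d) =
    (\<Sum>p<k. (A ^\<^sub>m p) $$ (a, b) * (B ^\<^sub>m (k - 1 - p)) $$ (c, d))"
  using i(4)
proof (induction k arbitrary: d)
  case 0
  then show ?case using assms by simp
next
  case (Suc k)
  let ?E = "munit m n b c"
  have D: "pow_divdiff A ?E B k \<in> carrier_mat m n" using A B by simp
  have "(pow_divdiff A ?E B k * B) $$ (a, d) = (\<Sum>x<n. pow_divdiff A ?E B k $$ (a, x) * B $$ (x, d))"
    using D B i Suc.prems by (simp add: scalar_prod_def atLeast0LessThan)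
  also have "\<dots> = (\<Sum>x<n. \<Sum>p<k. (A ^\<^sub>m p) $$ (a, b) * (B ^\<^sub>m (k - 1 - p)) $$ (c, x) * B $$ (x, d))"
    using Suc.IH by (simp add: sum_distrib_right)
  also have "\<dots> = (\<Sum>p<k. (A ^\<^sub>m p) $$ (a, b) * (\<Sum>x<n. (B ^\<^sub>m (k - 1 - p)) $$ (c, x) * B $$ (x, d)))"
    by (subst sum.swap) (simp add: sum_distrib_left mult.assoc)
  also have "\<dots> = (\<Sum>p<k. (A ^\<^sub>m p) $$ (a, b) * (B ^\<^sub>m (k - p)) $$ (c, d))"
  proof (rule sum.cong[OF refl])
    fix p assume "p \<in> {..<k}"
    then have "k - p = Suc (k - 1 - p)" by auto
    then have "(B ^\<^sub>m (k - p)) $$ (c, d) = (\<Sum>x<n. (B ^\<^sub>m (k - 1 - p)) $$ (c, x) * B $$ (x, d))"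
      using B i Suc.prems by (simp add: scalar_prod_def atLeast0LessThan)
    then show "(A ^\<^sub>m p) $$ (a, b) * (\<Sum>x<n. (B ^\<^sub>m (k - 1 - p)) $$ (c, x) * B $$ (x, d)) =
        (A ^\<^sub>m p) $$ (a, b) * (B ^\<^sub>m (k - p)) $$ (c, d)" by simp
  qed
  finally have 1: "(pow_divdiff A ?E B k * B) $$ (a, d) = (\<Sum>p<k. (A ^\<^sub>m p) $$ (a, b) * (B ^\<^sub>m (k - p)) $$ (c, d))" .
  have "(A ^\<^sub>m k * ?E) $$ (a, d) = (\<Sum>x<m. (A ^\<^sub>m k) $$ (a, x) * (if x = b \<and> d = c then 1 else 0))"
    using A i Suc.prems by (simp add: scalar_prod_def atLeast0LessThan munit_def)
  also have "\<dots> = (\<Sum>x<m. if x = b then (A ^\<^sub>m k) $$ (a, x) * (if d = c then 1 else 0) else 0)"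
    by (intro sum.cong) auto
  also have "\<dots> = (A ^\<^sub>m k) $$ (a, b) * (B ^\<^sub>m 0) $$ (c, d)"
    using B i Suc.prems by simp
  finally have 2: "(A ^\<^sub>m k * ?E) $$ (a, d) = (A ^\<^sub>m k) $$ (a, b) * (B ^\<^sub>m 0) $$ (c, d)" .
  have "pow_divdiff A ?E B (Suc k) $$ (a, d) = (pow_divdiff A ?E B k * B) $$ (a, d) + (A ^\<^sub>m k * ?E) $$ (a, d)"
    using A i Suc.prems by (simp add: munit_def del: index_mult_mat(1))
  then show ?case
    unfolding 1 2 by simp
qed

lemma four_block_upper_pow:
  assumes A: "A \<in> carrier_mat m m" and B: "B \<in> carrier_mat n n" and E: "E \<in> carrier_mat m n"
  shows "four_block_mat A (c \<cdot>\<^sub>m E) (0\<^sub>m n m) B ^\<^sub>m k =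
    four_block_mat (A ^\<^sub>m k) (c \<cdot>\<^sub>m pow_divdiff A E B k) (0\<^sub>m n m) (B ^\<^sub>m k)"
proof (induction k)
  case 0
  show ?case using A B by (intro eq_matI) auto
next
  case (Suc k)
  note D = pow_divdiff_carrier[OF A E B, of k]
  have "(c \<cdot>\<^sub>m pow_divdiff A E B k) * B = c \<cdot>\<^sub>m (pow_divdiff A E B k * B)"
    by (rule mult_smult_assoc_mat[OF D B])
  moreover have "A ^\<^sub>m k * (c \<cdot>\<^sub>m E) = c \<cdot>\<^sub>m (A ^\<^sub>m k * E)"
    by (rule mult_smult_distrib[OF pow_carrier_mat[OF A] E])
  moreover have "c \<cdot>\<^sub>m (A ^\<^sub>m k * E) + c \<cdot>\<^sub>m (pow_divdiff A E B k * B) =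
      c \<cdot>\<^sub>m (pow_divdiff A E B k * B + A ^\<^sub>m k * E)"
    using A B E by (intro eq_matI)
      (auto simp: D[THEN carrier_matD(1)] D[THEN carrier_matD(2)] algebra_simps simp del: index_mult_mat(1))
  ultimately show ?case
    unfolding pow_mat.simps Suc pow_divdiff.simps
    by (subst mult_four_block_mat[OF pow_carrier_mat[OF A] _ _ pow_carrier_mat[OF B] A _ _ B])
       (use A B E in \<open>simp_all add: mult_carrier_mat[OF D B] mult_carrier_mat[OF pow_carrier_mat[OF A] E] D
          right_mult_zero_mat[OF smult_carrier_mat[OF D]]
          right_add_zero_mat[OF mult_carrier_mat[OF pow_carrier_mat[OF A] A]]
          left_add_zero_mat[OF mult_carrier_mat[OF pow_carrier_mat[OF B] B]]\<close>)
qed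

text \<open>The factor \<open>r\<close> on the left avoids the exponent \<open>k - 1\<close>, which would be truncated at
  \<open>k = 0\<close>; the factor \<open>r\<^sup>2\<close> in the second order estimate below plays the same role.\<close>
lemma opnorm_pow_divdiff_le:
  assumes A: "A \<in> carrier_mat m m" and B: "B \<in> carrier_mat n n" and E: "E \<in> carrier_mat m n"
    and r: "opnorm A \<le> r" "opnorm B \<le> r"
  shows "r * opnorm (pow_divdiff A E B k) \<le> of_nat k * r ^ k * opnorm E"
proof (induction k)
  case 0
  have "opnorm (0\<^sub>m (dim_row A) (dim_col B)) \<le> 0"
    by (rule order_trans[OF opnorm_le_sum]) simp
  then show ?case using opnorm_nonneg[of "0\<^sub>m (dim_row A) (dim_col B)"] by simp
next
  case (Suc k)
  have r0: "0 \<le> r" using r opnorm_nonneg order_trans by blast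
  note D = pow_divdiff_carrier[OF A E B, of k]
  have "opnorm (pow_divdiff A E B (Suc k)) \<le> opnorm (pow_divdiff A E B k * B) + opnorm (A ^\<^sub>m k * E)"
    unfolding pow_divdiff.simps 
    by (rule opnorm_add_le[OF mult_carrier_mat[OF D B] mult_carrier_mat[OF pow_carrier_mat[OF A] E]])
  moreover have "opnorm (pow_divdiff A E B k * B) \<le> opnorm (pow_divdiff A E B k) * r"
    by (rule order_trans[OF opnorm_mult_le[OF D B] mult_left_mono[OF r(2)]]) simp
  moreover have "opnorm (A ^\<^sub>m k * E) \<le> r ^ k * opnorm E"
  proof -
    have "opnorm (A ^\<^sub>m k) \<le> r ^ k"
      by (rule order_trans[OF opnorm_pow_le[OF A] power_mono[OF r(1)]]) simp
    then show ?thesis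
      by (intro order_trans[OF opnorm_mult_le[OF pow_carrier_mat[OF A] E] mult_right_mono]) simp_all
  qed
  ultimately have "opnorm (pow_divdiff A E B (Suc k)) \<le> r * opnorm (pow_divdiff A E B k) + r ^ k * opnorm E"
    by (simp add: mult.commute)
  also have "\<dots> \<le> of_nat k * r ^ k * opnorm E + r ^ k * opnorm E"
    using Suc by simp
  finally have "r * opnorm (pow_divdiff A E B (Suc k)) \<le> r * (of_nat k * r ^ k * opnorm E + r ^ k * opnorm E)"
    using r0 by (rule mult_left_mono)
  then show ?case by (simp add: algebra_simps)
qed

lemma pow_divdiff_add:
  assumes A: "A \<in> carrier_mat m m" and B: "B \<in> carrier_mat n n"
    and E: "E \<in> carrier_mat m n" "F \<in> carrier_mat m n"
  shows "pow_divdiff A (E + F) B k = pow_divdiff A E B k + pow_divdiff A F B k"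
proof (induction k)
  case (Suc k)
  note D = pow_divdiff_carrier[OF A E(1) B, of k] pow_divdiff_carrier[OF A E(2) B, of k]
  show ?case
    unfolding pow_divdiff.simps Suc add_mult_distrib_mat[OF D B] mult_add_distrib_mat[OF pow_carrier_mat[OF A] E]
    using A B E by (intro eq_matI)
      (auto simp: D[THEN carrier_matD(1)] D[THEN carrier_matD(2)] simp del: index_mult_mat(1))
qed (use A B in auto)

lemma pow_divdiff_smult:
  assumes A: "A \<in> carrier_mat m m" and B: "B \<in> carrier_mat n n" and E: "E \<in> carrier_mat m n"
  shows "pow_divdiff A (c \<cdot>\<^sub>m E) B k = c \<cdot>\<^sub>m pow_divdiff A E B k"
proof (induction k)
  case (Suc k)
  note D = pow_divdiff_carrier[OF A E(1) B, of k]
  show ?case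
    unfolding pow_divdiff.simps Suc mult_smult_assoc_mat[OF D B] mult_smult_distrib[OF pow_carrier_mat[OF A] E]
    using A B E by (intro eq_matI)
      (auto simp: D[THEN carrier_matD(1)] D[THEN carrier_matD(2)] algebra_simps simp del: index_mult_mat(1))
qed (use A B in auto)

lemma pow_add_eq_divdiff:
  assumes A: "A \<in> carrier_mat n n" and H: "H \<in> carrier_mat n n"
  shows "(A + H) ^\<^sub>m k = A ^\<^sub>m k + pow_divdiff A H (A + H) k"
proof (induction k)
  case 0
  then show ?case using A H by auto
next
  case (Suc k)
  have AH: "A + H \<in> carrier_mat n n" using A H by simp
  note D = pow_divdiff_carrier[OF A H AH, of k] and P = pow_carrier_mat[OF A, of k]
  show ?case
    unfolding pow_mat.simps pow_divdiff.simps Suc add_mult_distrib_mat[OF P D AH] mult_add_distrib_mat[OF P A H]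
    using A H P by (intro eq_matI)
      (auto simp: D[THEN carrier_matD(1)] D[THEN carrier_matD(2)] simp del: index_mult_mat(1))
qed

text \<open>Second order Taylor estimate for the \<open>k\<close>-th power. If \<open>X\<close> is the remainder at step \<open>k\<close>, the
  remainder at step \<open>k + 1\<close> is \<open>X A + ((A + H)\<^sup>k - A\<^sup>k) H\<close>, and the difference of powers is
  \<open>pow_divdiff A H (A + H) k\<close>, whose norm is at most a multiple of that of \<open>H\<close>.\<close>
lemma opnorm_pow_taylor_le:
  assumes A: "A \<in> carrier_mat n n" and H: "H \<in> carrier_mat n n"
    and r: "opnorm A \<le> r" "opnorm (A + H) \<le> r"
  shows "\<exists>X \<in> carrier_mat n n. (A + H) ^\<^sub>m k = A ^\<^sub>m k + pow_divdiff A H A k + X \<and>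
    r\<^sup>2 * opnorm X \<le> (of_nat k)\<^sup>2 * r ^ k * (opnorm H)\<^sup>2"
proof (induction k)
  case 0
  have "opnorm (0\<^sub>m n n) \<le> 0" by (rule order_trans[OF opnorm_le_sum]) simp
  then show ?case using A H opnorm_nonneg[of "0\<^sub>m n n"]
    by (intro bexI[of _ "0\<^sub>m n n"]) auto
next
  case (Suc k)
  then obtain X where X: "X \<in> carrier_mat n n" "(A + H) ^\<^sub>m k = A ^\<^sub>m k + pow_divdiff A H A k + X"
    "r\<^sup>2 * opnorm X \<le> (of_nat k)\<^sup>2 * r ^ k * (opnorm H)\<^sup>2" by blast
  have r0: "0 \<le> r" using r opnorm_nonneg order_trans by blast
  have AH: "A + H \<in> carrier_mat n n" using A H by simp
  let ?D = "pow_divdiff A H A k" and ?P = "A ^\<^sub>m k" and ?F = "pow_divdiff A H (A + H) k"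
  have D: "?D \<in> carrier_mat n n" "?P \<in> carrier_mat n n" "?F \<in> carrier_mat n n"
    using A H AH by auto
  have FH: "?F * H \<in> carrier_mat n n" and XA: "X * A \<in> carrier_mat n n"
    by (rule mult_carrier_mat[OF D(3) H], rule mult_carrier_mat[OF X(1) A])
  have "(A + H) ^\<^sub>m Suc k = (A + H) ^\<^sub>m k * A + (A + H) ^\<^sub>m k * H"
    using A H by (simp add: mult_add_distrib_mat[of _ n n _ n])
  also have "(A + H) ^\<^sub>m k * A = ?P * A + ?D * A + X * A"
    unfolding X(2) using A D X by (simp add: add_mult_distrib_mat[of _ n n])
  also have "(A + H) ^\<^sub>m k * H = ?P * H + ?F * H"
    unfolding pow_add_eq_divdiff[OF A H] using H D by (simp add: add_mult_distrib_mat[of _ n n])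
  also have "?P * A + ?D * A + X * A + (?P * H + ?F * H) =
      A ^\<^sub>m Suc k + pow_divdiff A H A (Suc k) + (X * A + ?F * H)"
    using A H X by (intro eq_matI)
      (auto simp: D[THEN carrier_matD(1)] D[THEN carrier_matD(2)] simp del: index_mult_mat(1))
  finally have 1: "(A + H) ^\<^sub>m Suc k = A ^\<^sub>m Suc k + pow_divdiff A H A (Suc k) + (X * A + ?F * H)" .
  have "opnorm (X * A + ?F * H) \<le> opnorm (X * A) + opnorm (?F * H)"
    by (rule opnorm_add_le[OF XA FH])
  moreover have "opnorm (X * A) \<le> opnorm X * r"
    by (rule order_trans[OF opnorm_mult_le[OF X(1) A] mult_left_mono[OF r(1)]]) simp
  moreover have "opnorm (?F * H) \<le> opnorm ?F * opnorm H"
    by (rule opnorm_mult_le[OF D(3) H])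
  ultimately have "opnorm (X * A + ?F * H) \<le> r * opnorm X + opnorm ?F * opnorm H"
    by (simp add: mult.commute)
  then have "r\<^sup>2 * opnorm (X * A + ?F * H) \<le> r\<^sup>2 * (r * opnorm X + opnorm ?F * opnorm H)"
    by (rule mult_left_mono) simp
  also have "\<dots> = r * (r\<^sup>2 * opnorm X) + r * (r * opnorm ?F) * opnorm H"
    by (simp add: algebra_simps power2_eq_square)
  also have "\<dots> \<le> r * ((of_nat k)\<^sup>2 * r ^ k * (opnorm H)\<^sup>2) + r * (of_nat k * r ^ k * opnorm H) * opnorm H"
    using r0 X(3) opnorm_pow_divdiff_le[OF A AH H r, of k]
    by (intro add_mono mult_left_mono mult_right_mono) auto
  also have "\<dots> = ((of_nat k)\<^sup>2 + of_nat k) * (r ^ Suc k * (opnorm H)\<^sup>2)"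
    by (simp add: algebra_simps power2_eq_square)
  also have "\<dots> \<le> (of_nat (Suc k))\<^sup>2 * (r ^ Suc k * (opnorm H)\<^sup>2)"
    using r0 by (intro mult_right_mono) (auto simp: power2_eq_square algebra_simps)
  finally have 2: "r\<^sup>2 * opnorm (X * A + ?F * H) \<le> (of_nat (Suc k))\<^sup>2 * r ^ Suc k * (opnorm H)\<^sup>2"
    by (simp only: mult.assoc)
  show ?case
    by (intro bexI[of _ "X * A + ?F * H"] conjI 1 2 add_carrier_mat FH)
qed

section \<open>Matrix power series are stably matricial analytic\<close>
lemma matricial_disc_dsum:
  assumes "A \<in> matricial_disc R m" "B \<in> matricial_disc R n"
  shows "mat_dsum A B \<in> matricial_disc R (m + n)"
  using assms opnorm_dsum_le[of A m B n] by (auto simp: matricial_disc_def)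

lemma norm_pow_divdiff_entry_le:
  assumes A: "A \<in> carrier_mat m m" and B: "B \<in> carrier_mat n n" and E: "E \<in> carrier_mat m n"
    and r: "opnorm A \<le> r" "opnorm B \<le> r" "0 < r" and ij: "i < m" "j < n"
  shows "cmod (pow_divdiff A E B k $$ (i, j)) \<le> of_nat k * r ^ k * (opnorm E / r)"
proof -
  have "cmod (pow_divdiff A E B k $$ (i, j)) \<le> opnorm (pow_divdiff A E B k)"
    by (rule norm_entry_le_opnorm) (simp_all add: carrier_matD[OF pow_divdiff_carrier[OF A E B]] ij)
  also have "\<dots> \<le> of_nat k * r ^ k * (opnorm E / r)"
    using opnorm_pow_divdiff_le[OF A B E r(1,2), of k] r(3) by (simp add: field_simps)
  finally show ?thesis .
qed

lemma summable_pow_divdiff: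
  assumes a: "power_summable R a" and A: "A \<in> matricial_disc R m" and B: "B \<in> matricial_disc R n"
    and E: "E \<in> carrier_mat m n" and ij: "i < m" "j < n"
  shows "summable (\<lambda>k. a k * pow_divdiff A E B k $$ (i, j))"
proof -
  \<comment> \<open>any radius strictly between the norms and \<open>R\<close>\<close>
  define r where "r = (max (opnorm A) (opnorm B) + R) / 2"
  have r: "opnorm A \<le> r" "opnorm B \<le> r" "0 < r" "r < R"
    using A B opnorm_nonneg[of A] max.cobounded1[of "opnorm A" "opnorm B"]
    unfolding r_def matricial_disc_def by (auto simp del: opnorm_nonneg)
  have "summable (\<lambda>k. cmod (of_nat k * a k) * r ^ k * (opnorm E / r))"
    using r by (intro summable_mult2 power_summableD[OF power_summable_of_nat_mult[OF a]]) auto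
  then show ?thesis
  proof (rule summable_comparison_test'[where N = 0])
    fix k
    have "cmod (a k) * cmod (pow_divdiff A E B k $$ (i, j)) \<le> cmod (a k) * (of_nat k * r ^ k * (opnorm E / r))"
      by (intro mult_left_mono norm_pow_divdiff_entry_le[OF _ _ E r(1-3) ij])
         (use A B in \<open>auto simp: matricial_disc_def\<close>)
    then show "norm (a k * pow_divdiff A E B k $$ (i, j)) \<le> cmod (of_nat k * a k) * r ^ k * (opnorm E / r)"
      by (simp add: norm_mult mult_ac)
  qed
qed

lemma opnorm_le_entry_bound:
  assumes "A \<in> carrier_mat m n" "\<And>i j. i < m \<Longrightarrow> j < n \<Longrightarrow> cmod (A $$ (i, j)) \<le> c"
  shows "opnorm A \<le> of_nat m * of_nat n * c"
proof -
  have "opnorm A \<le> (\<Sum>i<m. \<Sum>j<n. cmod (A $$ (i, j)))"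
    using opnorm_le_sum[of A] assms by auto
  also have "\<dots> \<le> (\<Sum>i<m. \<Sum>j<n. c)"
    by (intro sum_mono assms) auto
  finally show ?thesis by simp
qed

text \<open>Summing the Taylor estimates for the powers: the derivative of the series is obtained term by
  term, with an error quadratic in \<open>H\<close> and uniform for \<open>A\<close> and \<open>A + H\<close> in a smaller ball.\<close>
lemma mat_series_second_order:
  assumes a: "power_summable R a" and A: "A \<in> carrier_mat n n" and H: "H \<in> carrier_mat n n"
    and r: "opnorm A \<le> r" "opnorm (A + H) \<le> r" "0 < r" "r < R" and ij: "i < n" "j < n"
  shows "cmod (mat_series a n (A + H) $$ (i, j) - mat_series a n A $$ (i, j)
            - (\<Sum>k. a k * pow_divdiff A H A k $$ (i, j)))
    \<le> (\<Sum>k. cmod (of_nat k * (of_nat k * a k)) * r ^ k) * ((opnorm H)\<^sup>2 / r\<^sup>2)"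
proof -
  have AD: "A \<in> matricial_disc R n" "A + H \<in> matricial_disc R n"
    using A H r by (auto simp: matricial_disc_def)
  obtain X where X: "\<And>k. X k \<in> carrier_mat n n"
      "\<And>k. (A + H) ^\<^sub>m k = A ^\<^sub>m k + pow_divdiff A H A k + X k"
      "\<And>k. r\<^sup>2 * opnorm (X k) \<le> (of_nat k)\<^sup>2 * r ^ k * (opnorm H)\<^sup>2"
    using opnorm_pow_taylor_le[OF A H r(1,2)] by metis
  note D = pow_divdiff_carrier[OF A H A]
  have 1: "a k * ((A + H) ^\<^sub>m k) $$ (i, j) - a k * (A ^\<^sub>m k) $$ (i, j) - a k * pow_divdiff A H A k $$ (i, j) =
      a k * X k $$ (i, j)" for k
    unfolding X(2) using A X(1)[of k] D[of k] ij by (simp add: algebra_simps)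
  have "(\<lambda>k. a k * X k $$ (i, j)) sums (mat_series a n (A + H) $$ (i, j) - mat_series a n A $$ (i, j)
            - (\<Sum>k. a k * pow_divdiff A H A k $$ (i, j)))"
    unfolding 1[symmetric]
    by (intro sums_diff mat_series_sums[OF a] AD ij summable_sums
        summable_pow_divdiff[OF a AD(1) AD(1) H ij])
  moreover have sm: "summable (\<lambda>k. cmod (of_nat k * (of_nat k * a k)) * r ^ k)"
    using r by (intro power_summableD[of R] power_summable_of_nat_mult a) auto
  then have sm: "summable (\<lambda>k. cmod (of_nat k * (of_nat k * a k)) * r ^ k * ((opnorm H)\<^sup>2 / r\<^sup>2))"
    by (rule summable_mult2)
  have le: "norm (a k * X k $$ (i, j)) \<le> cmod (of_nat k * (of_nat k * a k)) * r ^ k * ((opnorm H)\<^sup>2 / r\<^sup>2)" for k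
  proof -
    have "cmod (X k $$ (i, j)) \<le> opnorm (X k)"
      using X(1)[of k] ij by (intro norm_entry_le_opnorm) auto
    also have "\<dots> \<le> (of_nat k)\<^sup>2 * r ^ k * ((opnorm H)\<^sup>2 / r\<^sup>2)"
      using X(3)[of k] r(3) by (simp add: field_simps)
    finally have "cmod (a k) * cmod (X k $$ (i, j)) \<le> cmod (a k) * ((of_nat k)\<^sup>2 * r ^ k * ((opnorm H)\<^sup>2 / r\<^sup>2))"
      by (rule mult_left_mono) simp
    then show ?thesis by (simp add: norm_mult power2_eq_square mult_ac)
  qed
  have "norm (\<Sum>k. a k * X k $$ (i, j)) \<le> (\<Sum>k. cmod (of_nat k * (of_nat k * a k)) * r ^ k * ((opnorm H)\<^sup>2 / r\<^sup>2))"
    by (rule norm_suminf_le[OF le sm])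
  moreover have "(\<Sum>k. cmod (of_nat k * (of_nat k * a k)) * r ^ k * ((opnorm H)\<^sup>2 / r\<^sup>2)) =
      (\<Sum>k. cmod (of_nat k * (of_nat k * a k)) * r ^ k) * ((opnorm H)\<^sup>2 / r\<^sup>2)"
    using r by (intro suminf_mult2[symmetric] power_summableD[of R] power_summable_of_nat_mult a) auto
  ultimately show ?thesis by (simp add: sums_iff)
qed

lemma mat_series_analytic:
  assumes a: "power_summable R a"
  shows "mat_analytic_on n (mat_series a n) (matricial_disc R n)"
  unfolding mat_analytic_on_def
proof (intro conjI ballI)
  show "mat_series a n \<in> matricial_disc R n \<rightarrow> carrier_mat n n" by auto
  fix A assume AD: "A \<in> matricial_disc R n"
  then have A: "A \<in> carrier_mat n n" "opnorm A < R" by (auto simp: matricial_disc_def)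
  define L where "L H = mat n n (\<lambda>ij. \<Sum>k. a k * pow_divdiff A H A k $$ ij)" for H
  note D = pow_divdiff_carrier[OF A(1) _ A(1)]
  note sm = summable_pow_divdiff[OF a AD AD]
  define r where "r = (opnorm A + R) / 2"
  have r: "opnorm A < r" "0 < r" "r < R"
    using A(2) opnorm_nonneg[of A] unfolding r_def by (auto simp: field_simps simp del: opnorm_nonneg)
  define C where "C = (\<Sum>k. cmod (of_nat k * (of_nat k * a k)) * r ^ k) / r\<^sup>2"
  have C: "C \<ge> 0"
    unfolding C_def using r
    by (intro divide_nonneg_nonneg suminf_nonneg power_summableD[of R] power_summable_of_nat_mult a) auto
  show "\<exists>L. mat_clinear n L \<and> (\<forall>e>0. \<exists>d>0. \<forall>H\<in>carrier_mat n n. A + H \<in> matricial_disc R n \<longrightarrow>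
      opnorm H < d \<longrightarrow> opnorm (mat_series a n (A + H) - mat_series a n A - L H) \<le> e * opnorm H)"
  proof (rule exI[of _ L], intro conjI allI impI)
    show "mat_clinear n L"
      unfolding mat_clinear_def
    proof (intro conjI ballI allI)
      show "L \<in> carrier_mat n n \<rightarrow> carrier_mat n n" by (auto simp: L_def)
      fix H :: "complex mat" assume H: "H \<in> carrier_mat n n"
      show "L (H + K) = L H + L K" if K: "K \<in> carrier_mat n n" for K
      proof (rule eq_matI)
        fix i j assume "i < dim_row (L H + L K)" "j < dim_col (L H + L K)"
        then have ij: "i < n" "j < n" by (auto simp: L_def)
        then have "(\<Sum>k. a k * pow_divdiff A (H + K) A k $$ (i, j)) =
            (\<Sum>k. a k * pow_divdiff A H A k $$ (i, j) + a k * pow_divdiff A K A k $$ (i, j))"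
          unfolding pow_divdiff_add[OF A(1) A(1) H K]
          by (intro suminf_cong) (simp add: carrier_matD[OF D[OF K]] carrier_matD[OF D[OF H]] algebra_simps)
        also have "\<dots> = (\<Sum>k. a k * pow_divdiff A H A k $$ (i, j)) + (\<Sum>k. a k * pow_divdiff A K A k $$ (i, j))"
          by (intro suminf_add[symmetric] sm H K ij)
        finally show "L (H + K) $$ (i, j) = (L H + L K) $$ (i, j)"
          using ij by (simp add: L_def)
      qed (auto simp: L_def)
      fix c :: complex
      show "L (c \<cdot>\<^sub>m H) = c \<cdot>\<^sub>m L H"
      proof (rule eq_matI)
        fix i j assume "i < dim_row (c \<cdot>\<^sub>m L H)" "j < dim_col (c \<cdot>\<^sub>m L H)"
        then have ij: "i < n" "j < n" by (auto simp: L_def)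
        then have "(\<Sum>k. a k * pow_divdiff A (c \<cdot>\<^sub>m H) A k $$ (i, j)) =
            (\<Sum>k. c * (a k * pow_divdiff A H A k $$ (i, j)))"
          unfolding pow_divdiff_smult[OF A(1) A(1) H]
          by (intro suminf_cong) (simp add: carrier_matD[OF D[OF H]] mult_ac)
        also have "\<dots> = c * (\<Sum>k. a k * pow_divdiff A H A k $$ (i, j))"
          by (intro suminf_mult sm H ij)
        finally show "L (c \<cdot>\<^sub>m H) $$ (i, j) = (c \<cdot>\<^sub>m L H) $$ (i, j)"
          using ij by (simp add: L_def)
      qed (auto simp: L_def)
    qed
    fix e :: real assume e: "e > 0"
    \<comment> \<open>\<open>n\<^sup>2 C\<close> bounds the quadratic error; the summand \<open>1\<close> keeps \<open>N\<close> positive when \<open>C = 0\<close>\<close>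
    define N where "N = of_nat n * of_nat n * C + 1"
    have N: "N > 0" using C by (simp add: N_def add_nonneg_pos)
    show "\<exists>d>0. \<forall>H\<in>carrier_mat n n. A + H \<in> matricial_disc R n \<longrightarrow>
      opnorm H < d \<longrightarrow> opnorm (mat_series a n (A + H) - mat_series a n A - L H) \<le> e * opnorm H"
    proof (intro exI[of _ "min (r - opnorm A) (e / N)"] conjI ballI impI)
      show "0 < min (r - opnorm A) (e / N)" using r e N by auto
      fix H assume H: "H \<in> carrier_mat n n" and d: "opnorm H < min (r - opnorm A) (e / N)"
      have "opnorm (A + H) \<le> r"
        using opnorm_add_le[OF A(1) H] d by linarith
      then have "cmod ((mat_series a n (A + H) - mat_series a n A - L H) $$ (i, j)) \<le> C * (opnorm H)\<^sup>2"
        if ij: "i < n" "j < n" for i j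
        using mat_series_second_order[OF a A(1) H _ _ _ _ ij, of r] r ij
        by (simp add: C_def L_def)
      then have "opnorm (mat_series a n (A + H) - mat_series a n A - L H) \<le>
          of_nat n * of_nat n * (C * (opnorm H)\<^sup>2)"
        by (intro opnorm_le_entry_bound) (auto simp: L_def)
      also have "\<dots> \<le> N * (opnorm H)\<^sup>2"
        by (simp add: N_def algebra_simps)
      also have "\<dots> = N * opnorm H * opnorm H" by (simp add: power2_eq_square)
      also have "\<dots> \<le> e * opnorm H"
      proof (rule mult_right_mono)
        show "N * opnorm H \<le> e" using d N by (simp add: field_simps)
      qed simp
      finally show "opnorm (mat_series a n (A + H) - mat_series a n A - L H) \<le> e * opnorm H" .
    qed
  qed
qed

lemma mat_series_in_A_space:
  assumes a: "power_summable R a"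
  shows "mat_series a \<in> A_space (matricial_disc R)"
  unfolding A_space_def
  using mat_series_analytic[OF a] mat_series_similar[OF a]
  by (auto intro!: mat_series_dsum simp: matricial_disc_def)

section \<open>Every stably matricial analytic function is a power series\<close>

text \<open>Along complex lines a map that is analytic in the matrix sense has entries that are
  differentiable functions of one complex variable.\<close>
lemma mat_analytic_on_line_derivative:
  assumes F: "mat_analytic_on n F S" and A: "A \<in> S" and H: "H \<in> carrier_mat n n"
    and S: "\<delta> > 0" "\<And>\<epsilon>. cmod \<epsilon> < \<delta> \<Longrightarrow> A + \<epsilon> \<cdot>\<^sub>m H \<in> S" and SC: "S \<subseteq> carrier_mat n n"
    and ij: "i < n" "j < n"
  shows "\<exists>D. ((\<lambda>\<epsilon>. F (A + \<epsilon> \<cdot>\<^sub>m H) $$ (i, j)) has_field_derivative D) (at 0)"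
proof -
  from F A obtain L where L: "mat_clinear n L" and
    der: "\<And>e. e > 0 \<Longrightarrow> \<exists>d>0. \<forall>H\<in>carrier_mat n n. A + H \<in> S \<longrightarrow> opnorm H < d \<longrightarrow>
           opnorm (F (A + H) - F A - L H) \<le> e * opnorm H"
    unfolding mat_analytic_on_def by blast
  have FS: "F X \<in> carrier_mat n n" if "X \<in> S" for X
    using F that unfolding mat_analytic_on_def by auto
  have LH: "L H \<in> carrier_mat n n" and Lc: "L (c \<cdot>\<^sub>m H) = c \<cdot>\<^sub>m L H" for c
    using L H unfolding mat_clinear_def by auto
  have AC: "A \<in> carrier_mat n n" using A SC by auto
  have A0: "A + 0 \<cdot>\<^sub>m H = A"
    using AC H by (intro eq_matI) auto
  define h where "h = opnorm H + 1"
  have h: "h > 0" "opnorm H \<le> h" by (auto simp: h_def add_nonneg_pos)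
  have "((\<lambda>\<epsilon>. F (A + \<epsilon> \<cdot>\<^sub>m H) $$ (i, j)) has_derivative (*) (L H $$ (i, j))) (at 0)"
    unfolding has_derivative_at_alt
  proof (intro conjI allI impI)
    show "bounded_linear ((*) (L H $$ (i, j)))" by (rule bounded_linear_mult_right)
    fix e :: real assume "e > 0"
    then obtain d where d: "d > 0" "\<And>K. K \<in> carrier_mat n n \<Longrightarrow> A + K \<in> S \<Longrightarrow> opnorm K < d \<Longrightarrow>
           opnorm (F (A + K) - F A - L K) \<le> e / h * opnorm K"
      using der[of "e / h"] h by auto
    show "\<exists>d>0. \<forall>y. norm (y - 0) < d \<longrightarrow>
        norm (F (A + y \<cdot>\<^sub>m H) $$ (i, j) - F (A + 0 \<cdot>\<^sub>m H) $$ (i, j) - L H $$ (i, j) * (y - 0)) \<le> e * norm (y - 0)"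
    proof (intro exI[of _ "min \<delta> (d / h)"] conjI allI impI)
      show "min \<delta> (d / h) > 0" using S d h by auto
      fix y :: complex assume y: "norm (y - 0) < min \<delta> (d / h)"
      have yS: "A + y \<cdot>\<^sub>m H \<in> S" using S y by auto
      have le: "opnorm (y \<cdot>\<^sub>m H) \<le> cmod y * h"
        by (rule order_trans[OF opnorm_smult_le mult_left_mono[OF h(2)]]) simp
      also have "cmod y * h < d" using y h by (simp add: field_simps)
      finally have "opnorm (F (A + y \<cdot>\<^sub>m H) - F A - L (y \<cdot>\<^sub>m H)) \<le> e / h * opnorm (y \<cdot>\<^sub>m H)"
        using d(2) H yS by auto
      also have "\<dots> \<le> e / h * (cmod y * h)"
        using le \<open>e > 0\<close> h by (intro mult_left_mono) auto
      also have "\<dots> = e * cmod y" using h by simp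
      finally have "opnorm (F (A + y \<cdot>\<^sub>m H) - F A - y \<cdot>\<^sub>m L H) \<le> e * cmod y" by (simp add: Lc)
      moreover have "cmod ((F (A + y \<cdot>\<^sub>m H) - F A - y \<cdot>\<^sub>m L H) $$ (i, j)) \<le>
          opnorm (F (A + y \<cdot>\<^sub>m H) - F A - y \<cdot>\<^sub>m L H)"
        using LH ij by (intro norm_entry_le_opnorm) auto
      moreover have "(F (A + y \<cdot>\<^sub>m H) - F A - y \<cdot>\<^sub>m L H) $$ (i, j) =
          F (A + y \<cdot>\<^sub>m H) $$ (i, j) - F A $$ (i, j) - L H $$ (i, j) * y"
        using LH FS[OF A] ij by simp
      ultimately show "norm (F (A + y \<cdot>\<^sub>m H) $$ (i, j) - F (A + 0 \<cdot>\<^sub>m H) $$ (i, j) - L H $$ (i, j) * (y - 0)) \<le> e * norm (y - 0)"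
        by (simp add: A0)
    qed
  qed
  then show ?thesis unfolding has_field_derivative_def by blast
qed

lemma matricial_disc_open_line:
  assumes "A \<in> matricial_disc R n" "H \<in> carrier_mat n n"
  obtains \<delta> where "\<delta> > 0" "\<And>\<epsilon>. cmod \<epsilon> < \<delta> \<Longrightarrow> A + \<epsilon> \<cdot>\<^sub>m H \<in> matricial_disc R n"
proof
  have A: "A \<in> carrier_mat n n" "opnorm A < R" using assms by (auto simp: matricial_disc_def)
  have h: "opnorm H + 1 > 0" by (simp add: add_nonneg_pos)
  show "(R - opnorm A) / (opnorm H + 1) > 0" using A h by simp
  fix \<epsilon> assume e: "cmod \<epsilon> < (R - opnorm A) / (opnorm H + 1)"
  have "opnorm (A + \<epsilon> \<cdot>\<^sub>m H) \<le> opnorm A + opnorm (\<epsilon> \<cdot>\<^sub>m H)"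
    using A assms(2) by (intro opnorm_add_le) auto
  also have "opnorm (\<epsilon> \<cdot>\<^sub>m H) \<le> cmod \<epsilon> * opnorm H" by (rule opnorm_smult_le)
  also have "\<dots> \<le> cmod \<epsilon> * (opnorm H + 1)" by (intro mult_left_mono) auto
  also have "\<dots> < R - opnorm A" using e h by (simp add: field_simps)
  finally show "A + \<epsilon> \<cdot>\<^sub>m H \<in> matricial_disc R n"
    using A assms(2) by (auto simp: matricial_disc_def)
qed

lemma A_space_line_derivative:
  assumes f: "f \<in> A_space (matricial_disc R)" and n: "n \<ge> 1"
    and A: "A \<in> matricial_disc R n" and H: "H \<in> carrier_mat n n" and ij: "i < n" "j < n"
  shows "\<exists>D. ((\<lambda>\<epsilon>. f n (A + \<epsilon> \<cdot>\<^sub>m H) $$ (i, j)) has_field_derivative D) (at 0)"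
proof -
  obtain \<delta> where "\<delta> > 0" "\<And>\<epsilon>. cmod \<epsilon> < \<delta> \<Longrightarrow> A + \<epsilon> \<cdot>\<^sub>m H \<in> matricial_disc R n"
    using matricial_disc_open_line[OF A H] by metis
  moreover have "mat_analytic_on n (f n) (matricial_disc R n)"
    using f n by (auto simp: A_space_def)
  ultimately show ?thesis
    using A H ij by (intro mat_analytic_on_line_derivative) (auto simp: matricial_disc_def)
qed

lemma A_space_line_tendsto:
  assumes f: "f \<in> A_space (matricial_disc R)" and n: "n \<ge> 1"
    and A: "A \<in> matricial_disc R n" and H: "H \<in> carrier_mat n n" and ij: "i < n" "j < n"
  shows "((\<lambda>\<epsilon>. f n (A + \<epsilon> \<cdot>\<^sub>m H) $$ (i, j)) \<longlongrightarrow> f n A $$ (i, j)) (at 0)"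
proof -
  have "A + 0 \<cdot>\<^sub>m H = A"
    using A H by (intro eq_matI) (auto simp: matricial_disc_def)
  moreover have "isCont (\<lambda>\<epsilon>. f n (A + \<epsilon> \<cdot>\<^sub>m H) $$ (i, j)) 0"
    using A_space_line_derivative[OF assms] DERIV_isCont by blast
  ultimately show ?thesis by (simp add: isCont_def)
qed

lemma pow_mat_1_1: "mat 1 1 (\<lambda>_. z) ^\<^sub>m k = mat 1 1 (\<lambda>_. (z::complex) ^ k)"
  by (induction k) (auto intro!: eq_matI simp: scalar_prod_def)

lemma opnorm_1_1: "opnorm (mat 1 1 (\<lambda>_. z)) = cmod z"
proof (rule antisym)
  show "opnorm (mat 1 1 (\<lambda>_. z)) \<le> cmod z"
    by (rule order_trans[OF opnorm_le_sum]) simp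
  show "cmod z \<le> opnorm (mat 1 1 (\<lambda>_. z))"
    using norm_entry_le_opnorm[of 0 "mat 1 1 (\<lambda>_. z)" 0] by simp
qed

text \<open>At level one the matrices are scalars, so the function is an ordinary holomorphic function on a
  disc and is given by its Taylor series at \<open>0\<close>.\<close>
lemma A_space_level_one:
  assumes f: "f \<in> A_space (matricial_disc R)"
  obtains a where "power_summable R a"
    "\<And>z. cmod z < R \<Longrightarrow> f 1 (mat 1 1 (\<lambda>_. z)) = mat_series a 1 (mat 1 1 (\<lambda>_. z))"
proof -
  define \<phi> where "\<phi> z = f 1 (mat 1 1 (\<lambda>_. z)) $$ (0, 0)" for z
  have disc: "mat 1 1 (\<lambda>_. z) \<in> matricial_disc R 1" if "cmod z < R" for z
    using that opnorm_1_1[of z] by (simp add: matricial_disc_def)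
  have hol: "\<phi> holomorphic_on ball 0 R"
    unfolding holomorphic_on_open[OF open_ball]
  proof
    fix z assume "z \<in> ball (0::complex) R"
    then have z: "cmod z < R" by simp
    obtain D where "((\<lambda>\<epsilon>. f 1 (mat 1 1 (\<lambda>_. z) + \<epsilon> \<cdot>\<^sub>m 1\<^sub>m 1) $$ (0, 0)) has_field_derivative D) (at 0)"
      using A_space_line_derivative[OF f _ disc[OF z], of "1\<^sub>m 1" 0 0] by auto
    moreover have "mat 1 1 (\<lambda>_. z) + \<epsilon> \<cdot>\<^sub>m 1\<^sub>m 1 = mat 1 1 (\<lambda>_. \<epsilon> + z)" for \<epsilon>
      by (intro eq_matI) auto
    ultimately have "((\<lambda>\<epsilon>. \<phi> (\<epsilon> + z)) has_field_derivative D) (at 0)"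
      by (simp add: \<phi>_def)
    then show "\<exists>D. (\<phi> has_field_derivative D) (at z)"
      using DERIV_shift[of \<phi> D 0 z] by auto
  qed
  define a where "a k = (deriv ^^ k) \<phi> 0 / fact k" for k
  have sums: "(\<lambda>k. a k * z ^ k) sums \<phi> z" if "cmod z < R" for z
    using holomorphic_power_series[OF hol, of z] that by (simp add: a_def)
  have "power_summable R a"
    unfolding power_summable_def
  proof (intro allI impI)
    fix r :: real assume r: "0 \<le> r" "r < R"
    then obtain x where x: "r < x" "x < R" using dense by blast
    have "summable (\<lambda>k. a k * (of_real x) ^ k)"
      using sums[of "of_real x"] x r by (auto simp: sums_iff)
    then have "summable (\<lambda>k. norm (a k * (of_real r) ^ k))"
      by (rule powser_insidea) (use r x in auto)
    then show "summable (\<lambda>k. cmod (a k) * r ^ k)"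
      using r by (simp add: norm_mult norm_power)
  qed
  moreover have "f 1 (mat 1 1 (\<lambda>_. z)) = mat_series a 1 (mat 1 1 (\<lambda>_. z))" if z: "cmod z < R" for z
  proof -
    have "mat_analytic_on 1 (f 1) (matricial_disc R 1)" using f by (auto simp: A_space_def)
    then have "f 1 (mat 1 1 (\<lambda>_. z)) \<in> carrier_mat 1 1"
      using disc[OF z] by (auto simp: mat_analytic_on_def)
    then show ?thesis
      using sums[OF z] by (intro eq_matI) (auto simp: mat_series_def pow_mat_1_1[simplified] \<phi>_def sums_iff)
  qed
  ultimately show ?thesis using that by blast
qed

lemma order_prod_linear_distinct:
  assumes "distinct xs"
  shows "order z (\<Prod>x\<leftarrow>xs. [:- x, 1::complex:]) \<le> 1"
proof -
  have "order z (\<Prod>x\<leftarrow>xs. [:- x, 1::complex:]) = count_list xs z"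
  proof (induction xs)
    case (Cons x xs)
    have "(\<Prod>x\<leftarrow>xs. [:- x, 1::complex:]) \<noteq> 0"
      by (auto simp: prod_list_zero_iff)
    then have nz: "[:- x, 1:] * (\<Prod>x\<leftarrow>xs. [:- x, 1::complex:]) \<noteq> 0"
      by (rule no_zero_divisors[rotated]) simp
    have "order z [:- x, 1:] = (if x = z then 1 else 0)"
      using order_power_n_n[of z 1] by (auto simp: order_0I)
    then show ?case using Cons order_mult[OF nz, of z] by simp
  qed simp
  also have "\<dots> \<le> 1"
    using assms by (induction xs) auto
  finally show ?thesis .
qed

text \<open>Diagonal matrices are encoded as Jordan matrices all of whose blocks have size \<open>1\<close>, because these
  are built by iterated direct sums.\<close>
lemma diagonalizable_triangular_distinct:
  assumes B: "(B :: complex mat) \<in> carrier_mat n n" and tri: "upper_triangular B"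
    and dist: "distinct (diag_mat B)"
  obtains xs where "similar_mat B (jordan_matrix (map (Pair 1) xs))"
    "\<And>x. x \<in> set xs \<Longrightarrow> eigenvalue B x"
proof -
  have cp: "char_poly B = (\<Prod>x\<leftarrow>diag_mat B. [:- x, 1:])"
    by (rule char_poly_upper_triangular[OF B tri])
  obtain n_as where jnf: "jordan_nf B n_as" using jordan_nf_exists[OF B cp] by blast
  have 1: "k = 1" "eigenvalue B x" if "(k, x) \<in> set n_as" for k x
  proof -
    have "k \<noteq> 0" using jnf that by (force simp: jordan_nf_def)
    moreover have le: "k \<le> order x (char_poly B)" by (rule jordan_nf_block_size_order_bound[OF jnf that])
    moreover have "order x (char_poly B) \<le> 1"
      unfolding cp by (rule order_prod_linear_distinct[OF dist])
    ultimately show "k = 1" by simp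
    have "order x (char_poly B) \<noteq> 0" using le \<open>k \<noteq> 0\<close> by simp
    then have "poly (char_poly B) x = 0" using order_root by blast
    then show "eigenvalue B x" using eigenvalue_root_char_poly[OF B] by simp
  qed
  have "n_as = map (Pair 1) (map snd n_as)"
    using 1(1) by (intro nth_equalityI) (force simp: set_conv_nth prod_eq_iff)+
  moreover have "similar_mat B (jordan_matrix n_as)" using jnf by (simp add: jordan_nf_def)
  ultimately have "similar_mat B (jordan_matrix (map (Pair 1) (map snd n_as)))" by metis
  then show ?thesis
    by (rule that[of "map snd n_as"]) (use 1(2) in auto)
qed

lemma A_space_eq_series_diagonal:
  assumes f: "f \<in> A_space (matricial_disc R)" 
    and f1: "\<And>z. cmod z < R \<Longrightarrow> f 1 (mat 1 1 (\<lambda>_. z)) = mat_series a 1 (mat 1 1 (\<lambda>_. z))"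
    and xs: "xs \<noteq> []" "\<And>x. x \<in> set xs \<Longrightarrow> cmod x < R"
  shows "jordan_matrix (map (Pair 1) xs) \<in> matricial_disc R (length xs) \<and>
    f (length xs) (jordan_matrix (map (Pair 1) xs)) =
    mat_series a (length xs) (jordan_matrix (map (Pair 1) xs))"
  using xs
proof (induction xs rule: list_nonempty_induct)
  have jb: "jordan_block 1 x = mat 1 1 (\<lambda>_. x)" for x :: complex
    by (intro eq_matI) auto
  have j1: "mat 1 1 (\<lambda>_. x) \<in> matricial_disc R 1" if "cmod x < R" for x
    using that opnorm_1_1[of x] by (simp add: matricial_disc_def)
  {
    case (single x)
    have "jordan_matrix (map (Pair 1) [x]) = mat 1 1 (\<lambda>_. x)"
      by (simp only: jordan_matrix_def list.map prod.case diag_block_mat_singleton jb)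
    then show ?case using j1[of x] f1[of x] single by simp
  next
    case (cons x xs)
    let ?J = "jordan_matrix (map (Pair 1) xs)"
    have "jordan_matrix (map (Pair 1) (x # xs)) = diag_block_mat (mat 1 1 (\<lambda>_. x) # map (\<lambda>(n, a). jordan_block n a) (map (Pair 1) xs))"
      unfolding jordan_matrix_def by (simp add: jb[simplified])
    also have "\<dots> = mat_dsum (mat 1 1 (\<lambda>_. x)) ?J"
      unfolding mat_dsum_four_block by (simp add: jordan_matrix_def Let_def)
    finally have eq: "jordan_matrix (map (Pair 1) (x # xs)) = mat_dsum (mat 1 1 (\<lambda>_. x)) ?J" .
    have x: "cmod x < R" and IH: "?J \<in> matricial_disc R (length xs)"
      "f (length xs) ?J = mat_series a (length xs) ?J"
      using cons by auto
    have l: "length xs \<ge> 1" using cons.hyps by (cases xs) auto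
    have "f (1 + length xs) (mat_dsum (mat 1 1 (\<lambda>_. x)) ?J) =
        mat_dsum (f 1 (mat 1 1 (\<lambda>_. x))) (f (length xs) ?J)"
      using f l IH(1) j1[OF x] unfolding A_space_def by blast
    also have "\<dots> = mat_series a (1 + length xs) (mat_dsum (mat 1 1 (\<lambda>_. x)) ?J)"
      unfolding f1[OF x] IH(2)
      by (rule mat_series_dsum[symmetric]) (use IH in \<open>auto simp: matricial_disc_def\<close>)
    finally show ?case
      using matricial_disc_dsum[OF j1[OF x] IH(1)] unfolding eq by simp
  }
qed

text \<open>Similarity invariance is only available between points of the disc. The diagonal form of a
  matrix in the disc stays in the disc, since eigenvalues are bounded by the operator norm.\<close>
lemma A_space_eq_series_diagonalizable:
  assumes f: "f \<in> A_space (matricial_disc R)" and a: "power_summable R a"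
    and f1: "\<And>z. cmod z < R \<Longrightarrow> f 1 (mat 1 1 (\<lambda>_. z)) = mat_series a 1 (mat 1 1 (\<lambda>_. z))"
    and n: "n \<ge> 1" and A: "A \<in> matricial_disc R n"
    and sim: "similar_mat A (jordan_matrix (map (Pair 1) xs))"
    and ev: "\<And>x. x \<in> set xs \<Longrightarrow> eigenvalue A x"
  shows "f n A = mat_series a n A"
proof -
  let ?J = "jordan_matrix (map (Pair 1) xs)"
  have Ac: "A \<in> carrier_mat n n" "opnorm A < R" using A by (auto simp: matricial_disc_def)
  obtain P Q where w: "similar_mat_wit A ?J P Q" using sim unfolding similar_mat_def by blast
  have "?J \<in> carrier_mat n n" using similar_mat_witD2[OF Ac(1) w] by auto
  moreover have "dim_row ?J = length xs"
    by (simp add: o_def sum_list_triv)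
  ultimately have l: "length xs = n" by auto
  have "cmod x < R" if "x \<in> set xs" for x
    using norm_eigenvalue_le_opnorm[OF Ac(1) ev[OF that]] Ac(2) by simp
  moreover have "xs \<noteq> []" using l n by auto
  ultimately have J: "?J \<in> matricial_disc R n" "f n ?J = mat_series a n ?J"
    using A_space_eq_series_diagonal[OF f f1, of xs] l by auto
  have "f n A = P * f n ?J * Q"
    using f n A J(1) w unfolding A_space_def by blast
  also have "\<dots> = mat_series a n A"
    unfolding J(2) by (rule mat_series_similar[OF a J(1) w, symmetric])
  finally show ?thesis .
qed

text \<open>Bring \<open>A\<close> to a triangular form \<open>J\<close> and move along \<open>J + \<epsilon> diag(0, 1, \<dots>, n - 1)\<close>. For all but
  finitely many \<open>\<epsilon>\<close> the diagonal entries are distinct, so these perturbations of \<open>A\<close> are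
  diagonalizable; let \<open>\<epsilon>\<close> tend to \<open>0\<close>.\<close>
lemma A_space_eq_mat_series:
  assumes f: "f \<in> A_space (matricial_disc R)"
  obtains a where "power_summable R a" "eq_on_family (matricial_disc R) f (mat_series a)"
proof -
  obtain a where a: "power_summable R a"
    and f1: "\<And>z. cmod z < R \<Longrightarrow> f 1 (mat 1 1 (\<lambda>_. z)) = mat_series a 1 (mat 1 1 (\<lambda>_. z))"
    using A_space_level_one[OF f] by metis
  have "f n A = mat_series a n A" if n: "n \<ge> 1" and A: "A \<in> matricial_disc R n" for n A
  proof -
    have Ac: "A \<in> carrier_mat n n" using A by (auto simp: matricial_disc_def)
    obtain as where "char_poly A = (\<Prod>x\<leftarrow>as. [:- x, 1:])" using char_poly_factorized[OF Ac] by blast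
    then obtain n_as where "jordan_nf A n_as" using jordan_nf_exists[OF Ac] by blast
    then obtain P Q where w: "similar_mat_wit A (jordan_matrix n_as) P Q"
      unfolding jordan_nf_def similar_mat_def by blast
    define J where "J = jordan_matrix n_as"
    note wd = similar_mat_witD2[OF Ac w, folded J_def]
    have J: "J \<in> carrier_mat n n" by (rule wd)
    have triJ: "J $$ (i, j) = 0" if "i < n" "j < i" for i j
      unfolding J_def using that J by (intro jordan_matrix_upper_triangular) (auto simp: J_def)
    define E where "E = mat n n (\<lambda>(i, j). if i = j then of_nat i else (0::complex))"
    have E: "E \<in> carrier_mat n n" by (simp add: E_def)
    define H where "H = P * E * Q"
    have H: "H \<in> carrier_mat n n" using wd E by (auto simp: H_def)
    define B where "B \<epsilon> = J + \<epsilon> \<cdot>\<^sub>m E" for \<epsilon>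
    have B: "B \<epsilon> \<in> carrier_mat n n" for \<epsilon> using J E by (simp add: B_def)
    have simB: "similar_mat_wit (A + \<epsilon> \<cdot>\<^sub>m H) (B \<epsilon>) P Q" for \<epsilon>
    proof (rule similar_mat_witI[of _ _ n])
      have "P * B \<epsilon> * Q = (P * J + P * (\<epsilon> \<cdot>\<^sub>m E)) * Q"
        unfolding B_def using wd E by (subst mult_add_distrib_mat[of P n n J n]) auto
      also have "\<dots> = P * J * Q + P * (\<epsilon> \<cdot>\<^sub>m E) * Q"
        using wd E by (intro add_mult_distrib_mat[of _ n n _ _ n]) auto
      also have "P * (\<epsilon> \<cdot>\<^sub>m E) * Q = \<epsilon> \<cdot>\<^sub>m H"
        unfolding H_def using wd(6,7) E
        by (simp add: mult_smult_distrib[of P n n] mult_smult_assoc_mat[of "P * E" n n])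
      finally show "A + \<epsilon> \<cdot>\<^sub>m H = P * B \<epsilon> * Q" using wd(3) by simp
    qed (use wd Ac H B in auto)
    have simB': "similar_mat (A + \<epsilon> \<cdot>\<^sub>m H) (B \<epsilon>)" for \<epsilon>
      using simB unfolding similar_mat_def by blast
    have triB: "upper_triangular (B \<epsilon>)" for \<epsilon>
      unfolding upper_triangular_def using triJ J E by (auto simp: B_def E_def)
    have eq: "f n (A + \<epsilon> \<cdot>\<^sub>m H) = mat_series a n (A + \<epsilon> \<cdot>\<^sub>m H)"
      if d: "distinct (diag_mat (B \<epsilon>))" and D: "A + \<epsilon> \<cdot>\<^sub>m H \<in> matricial_disc R n" for \<epsilon>
    proof -
      obtain xs where xs: "similar_mat (B \<epsilon>) (jordan_matrix (map (Pair 1) xs))"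
        "\<And>x. x \<in> set xs \<Longrightarrow> eigenvalue (B \<epsilon>) x"
        using diagonalizable_triangular_distinct[OF B triB d] by metis
      have "eigenvalue (A + \<epsilon> \<cdot>\<^sub>m H) x" if "x \<in> set xs" for x
        using xs(2)[OF that] char_poly_similar[OF simB'[of \<epsilon>]] eigenvalue_root_char_poly[OF B[of \<epsilon>]]
          eigenvalue_root_char_poly[of "A + \<epsilon> \<cdot>\<^sub>m H" n] Ac H by auto
      then show ?thesis
        using A_space_eq_series_diagonalizable[OF f a f1 n D similar_mat_trans[OF simB' xs(1)]] by blast
    qed
    have ev1: "\<forall>\<^sub>F \<epsilon> in at 0. A + \<epsilon> \<cdot>\<^sub>m H \<in> matricial_disc R n"
    proof -
      obtain \<delta> where "\<delta> > 0" "\<And>\<epsilon>. cmod \<epsilon> < \<delta> \<Longrightarrow> A + \<epsilon> \<cdot>\<^sub>m H \<in> matricial_disc R n"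
        using matricial_disc_open_line[OF A H] by metis
      then show ?thesis unfolding eventually_at by (auto simp: dist_norm)
    qed
    have ev2: "\<forall>\<^sub>F \<epsilon> in at 0. distinct (diag_mat (B \<epsilon>))"
    proof -
      have "\<forall>\<^sub>F \<epsilon> in at 0. \<forall>i\<in>{..<n}. \<forall>j\<in>{..<n}. i \<noteq> j \<longrightarrow>
          \<epsilon> \<noteq> (J $$ (j, j) - J $$ (i, i)) / (of_nat i - of_nat j)"
        by (auto simp: eventually_ball_finite_distrib intro!: eventually_neq_at_within)
      then show ?thesis
      proof eventually_elim
        case (elim \<epsilon>)
        have "J $$ (i, i) + \<epsilon> * of_nat i \<noteq> J $$ (j, j) + \<epsilon> * of_nat j" if "i < n" "j < n" "i \<noteq> j" for i j
        proof
          assume "J $$ (i, i) + \<epsilon> * of_nat i = J $$ (j, j) + \<epsilon> * of_nat j"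
          then have "\<epsilon> * (of_nat i - of_nat j) = J $$ (j, j) - J $$ (i, i)" by (simp add: algebra_simps)
          moreover have "of_nat i - of_nat j \<noteq> (0::complex)" using that by simp
          ultimately have "\<epsilon> = (J $$ (j, j) - J $$ (i, i)) / (of_nat i - of_nat j)"
            by (simp add: field_simps)
          then show False using elim that by auto
        qed
        then show ?case
          using J by (auto simp: distinct_conv_nth diag_mat_def B_def E_def)
      qed
    qed
    show ?thesis
    proof (rule eq_matI)
      have fc: "f n A \<in> carrier_mat n n"
        using f n A by (auto simp: A_space_def mat_analytic_on_def)
      then show "dim_row (f n A) = dim_row (mat_series a n A)" "dim_col (f n A) = dim_col (mat_series a n A)"
        by auto
      fix i j assume "i < dim_row (mat_series a n A)" "j < dim_col (mat_series a n A)"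
      then have ij: "i < n" "j < n" by auto
      have "((\<lambda>\<epsilon>. f n (A + \<epsilon> \<cdot>\<^sub>m H) $$ (i, j)) \<longlongrightarrow> f n A $$ (i, j)) (at 0)"
        by (rule A_space_line_tendsto[OF f n A H ij])
      moreover have "\<forall>\<^sub>F \<epsilon> in at 0. f n (A + \<epsilon> \<cdot>\<^sub>m H) $$ (i, j) = mat_series a n (A + \<epsilon> \<cdot>\<^sub>m H) $$ (i, j)"
        using ev1 ev2 by eventually_elim (simp add: eq)
      ultimately have "((\<lambda>\<epsilon>. mat_series a n (A + \<epsilon> \<cdot>\<^sub>m H) $$ (i, j)) \<longlongrightarrow> f n A $$ (i, j)) (at 0)"
        by (rule Lim_transform_eventually)
      then show "f n A $$ (i, j) = mat_series a n A $$ (i, j)"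
        using A_space_line_tendsto[OF mat_series_in_A_space[OF a] n A H ij]
        by (intro tendsto_unique[of "at 0"]) auto
    qed
  qed
  then show ?thesis using a that unfolding eq_on_family_def by blast
qed

section \<open>The operators on power series\<close>
lemma sim_ext_eq_series:
  assumes a: "power_summable R a" and f: "eq_on_family (matricial_disc R) f (mat_series a)"
    and n: "n \<ge> 1" and A: "A \<in> matricial_disc R n"
  shows "sim_ext (matricial_disc R) f n A = mat_series a n A"
proof -
  have Ac: "A \<in> carrier_mat n n" using A by (auto simp: matricial_disc_def)
  have fs: "f n w = mat_series a n w" if "w \<in> matricial_disc R n" for w
    using f n that by (auto simp: eq_on_family_def)
  have 1: "Y = mat_series a n A" if "\<exists>w\<in>matricial_disc R n. \<exists>s t. similar_mat_wit A w s t \<and> Y = s * f n w * t" for Y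
    using that mat_series_similar[OF a] fs by metis
  have "similar_mat_wit A A (1\<^sub>m n) (1\<^sub>m n)" by (rule similar_mat_wit_refl[OF Ac])
  then have 2: "\<exists>Y. \<exists>w\<in>matricial_disc R n. \<exists>s t. similar_mat_wit A w s t \<and> Y = s * f n w * t"
    using A by blast
  show ?thesis
    unfolding sim_ext_def by (rule 1[OF someI_ex[OF 2]])
qed

text \<open>The value of the series \<open>\<Sum> a\<^sub>t \<Sum> A\<^sup>p \<otimes> B\<^sup>q\<close>, inner sum over \<open>p + q = t - 1\<close>, at the coefficient of
  the pair of matrix units with positions \<open>(i, j)\<close> and \<open>(k, l)\<close>. It is the divided
  difference of \<open>\<Sum> a\<^sub>t z\<^sup>t\<close> in tensor form.\<close>
definition series_divdiff :: "(nat \<Rightarrow> complex) \<Rightarrow> complex mat \<Rightarrow> complex mat \<Rightarrow> nat \<Rightarrow> nat \<Rightarrow> nat \<Rightarrow> nat \<Rightarrow> complex" where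
  "series_divdiff a A B i j k l =
     (\<Sum>t. a t * (\<Sum>p<t. (A ^\<^sub>m p) $$ (i, j) * (B ^\<^sub>m (t - 1 - p)) $$ (k, l)))"

lemma series_divdiff_sums:
  assumes a: "power_summable R a" and A: "A \<in> matricial_disc R m" and B: "B \<in> matricial_disc R n"
    and ij: "i < m" "j < m" "k < n" "l < n"
  shows "(\<lambda>t. a t * (\<Sum>p<t. (A ^\<^sub>m p) $$ (i, j) * (B ^\<^sub>m (t - 1 - p)) $$ (k, l)))
    sums series_divdiff a A B i j k l"
proof -
  have "A \<in> carrier_mat m m" "B \<in> carrier_mat n n" using A B by (auto simp: matricial_disc_def)
  from pow_divdiff_munit[OF this ij] summable_pow_divdiff[OF a A B munit_carrier ij(1,4), of j k]
  show ?thesis unfolding series_divdiff_def by (simp add: summable_sums)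
qed

text \<open>For small \<open>\<epsilon>\<close> the block matrix lies in the disc itself, so the extension to the similarity
  envelope agrees with the power series there, and the corner of the series is exactly linear
  in \<open>\<epsilon>\<close>.\<close>
lemma deriv_sim_ext_block:
  assumes a: "power_summable R a" and f: "eq_on_family (matricial_disc R) f (mat_series a)"
    and m: "m \<ge> 1" and A: "A \<in> matricial_disc R m" and B: "B \<in> matricial_disc R n"
    and ij: "i < m" "j < m" "k < n" "l < n"
  shows "deriv (\<lambda>\<epsilon>. sim_ext (matricial_disc R) f (m + n)
       (four_block_mat A (\<epsilon> \<cdot>\<^sub>m munit m n j k) (0\<^sub>m n m) B) $$ (i, m + l)) 0 = series_divdiff a A B i j k l"
proof -
  have Ac: "A \<in> carrier_mat m m" and Bc: "B \<in> carrier_mat n n" using A B by (auto simp: matricial_disc_def)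
  define E where "E = four_block_mat (0\<^sub>m m m) (munit m n j k) (0\<^sub>m n m) (0\<^sub>m n n)"
  have E: "E \<in> carrier_mat (m + n) (m + n)" by (simp add: E_def)
  define M where "M \<epsilon> = four_block_mat A (\<epsilon> \<cdot>\<^sub>m munit m n j k) (0\<^sub>m n m) B" for \<epsilon>
  have M: "M \<epsilon> = mat_dsum A B + \<epsilon> \<cdot>\<^sub>m E" for \<epsilon>
    unfolding M_def E_def mat_dsum_four_block using Ac Bc
    by (intro eq_matI) (auto simp: munit_def)
  obtain \<delta> where \<delta>: "\<delta> > 0" "\<And>\<epsilon>. cmod \<epsilon> < \<delta> \<Longrightarrow> M \<epsilon> \<in> matricial_disc R (m + n)"
    unfolding M using matricial_disc_open_line[OF matricial_disc_dsum[OF A B] E] by metis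
  have eq: "sim_ext (matricial_disc R) f (m + n) (M \<epsilon>) $$ (i, m + l) = series_divdiff a A B i j k l * \<epsilon>"
    if "cmod \<epsilon> < \<delta>" for \<epsilon>
  proof -
    have "sim_ext (matricial_disc R) f (m + n) (M \<epsilon>) $$ (i, m + l) = (\<Sum>t. a t * (M \<epsilon> ^\<^sub>m t) $$ (i, m + l))"
      using sim_ext_eq_series[OF a f _ \<delta>(2)[OF that]] m ij by (simp add: mat_series_def)
    also have "\<dots> = (\<Sum>t. a t * (\<Sum>p<t. (A ^\<^sub>m p) $$ (i, j) * (B ^\<^sub>m (t - 1 - p)) $$ (k, l)) * \<epsilon>)"
    proof (rule suminf_cong)
      fix t
      have "(M \<epsilon> ^\<^sub>m t) $$ (i, m + l) = \<epsilon> * pow_divdiff A (munit m n j k) B t $$ (i, l)"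
        unfolding M_def four_block_upper_pow[OF Ac Bc munit_carrier]
        using ij Ac Bc carrier_matD[OF pow_divdiff_carrier[OF Ac munit_carrier Bc]] by simp
      then show "a t * (M \<epsilon> ^\<^sub>m t) $$ (i, m + l) =
          a t * (\<Sum>p<t. (A ^\<^sub>m p) $$ (i, j) * (B ^\<^sub>m (t - 1 - p)) $$ (k, l)) * \<epsilon>"
        unfolding pow_divdiff_munit[OF Ac Bc ij] by simp
    qed
    also have "\<dots> = series_divdiff a A B i j k l * \<epsilon>"
      using series_divdiff_sums[OF a A B ij] by (simp add: sums_iff suminf_mult2[symmetric])
    finally show ?thesis .
  qed
  have "((\<lambda>\<epsilon>. series_divdiff a A B i j k l * \<epsilon>) has_field_derivative series_divdiff a A B i j k l) (at 0)"
    by (auto intro!: derivative_eq_intros)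
  then have "((\<lambda>\<epsilon>. sim_ext (matricial_disc R) f (m + n) (M \<epsilon>) $$ (i, m + l))
      has_field_derivative series_divdiff a A B i j k l) (at 0)"
    by (rule has_field_derivative_transform_within_open[where S = "ball 0 \<delta>"]) (use eq \<delta>(1) in auto)
  then show ?thesis unfolding M_def by (rule DERIV_imp_deriv)
qed

lemma pair_index_less: "i < m \<Longrightarrow> k < n \<Longrightarrow> i * n + k < m * (n::nat)"
proof -
  assume "i < m" "k < n"
  then have "i * n + k < Suc i * n" by simp
  also have "\<dots> \<le> m * n" using \<open>i < m\<close> by (intro mult_right_mono) auto
  finally show ?thesis .
qed

lemma sum_delta4:
  fixes F :: "nat \<Rightarrow> nat \<Rightarrow> nat \<Rightarrow> nat \<Rightarrow> complex"
  assumes "i < m" "j < m" "k < n" "l < n"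
  shows "(\<Sum>i'<m. \<Sum>j'<m. \<Sum>k'<n. \<Sum>l'<n. F i' j' k' l' *
           (if i' = i \<and> j' = j \<and> k' = k \<and> l' = l then 1 else 0)) = F i j k l"
proof -
  have "(\<Sum>i'<m. \<Sum>j'<m. \<Sum>k'<n. \<Sum>l'<n. F i' j' k' l' *
           (if i' = i \<and> j' = j \<and> k' = k \<and> l' = l then 1 else 0)) =
    (\<Sum>i'<m. \<Sum>j'<m. \<Sum>k'<n. \<Sum>l'<n. if l' = l then if k' = k then if j' = j then if i' = i
      then F i' j' k' l' else 0 else 0 else 0 else 0)"
    by (intro sum.cong refl) auto
  then show ?thesis using assms by simp
qed

lemma munit_sum_kron_index:
  assumes "i < m" "j < m" "k < n" "l < n"
  shows "munit_sum m n (m * n) kron t $$ (i * n + k, j * n + l) = t i j k l"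
proof -
  have "munit_sum m n (m * n) kron t $$ (i * n + k, j * n + l) =
    (\<Sum>i'<m. \<Sum>j'<m. \<Sum>k'<n. \<Sum>l'<n. t i' j' k' l' *
           (if i' = i \<and> j' = j \<and> k' = k \<and> l' = l then 1 else 0))"
    unfolding munit_sum_def
    using assms pair_index_less[OF assms(1,3)] pair_index_less[OF assms(2,4)]
    by (auto intro!: sum.cong simp: kron_coeff[of _ m _ n] munit_def)
  then show ?thesis by (simp add: sum_delta4[OF assms])
qed

lemma tensor_flip_index:
  assumes "i < n" "j < n" "k < m" "l < m"
  shows "tensor_flip m n T $$ (i * m + k, j * m + l) = T $$ (k * n + i, l * n + j)"
proof -
  have "tensor_flip m n T $$ (i * m + k, j * m + l) =
    (\<Sum>i'<m. \<Sum>j'<m. \<Sum>k'<n. \<Sum>l'<n. T $$ (i' * n + k', j' * n + l') *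
           (if i' = k \<and> j' = l \<and> k' = i \<and> l' = j then 1 else 0))"
    unfolding tensor_flip_def tensor_lift_def munit_sum_def
    using assms pair_index_less[OF assms(1,3)] pair_index_less[OF assms(2,4)]
    by (auto intro!: sum.cong simp: kron_coeff[of _ n _ m] munit_def mult.commute[of m n])
  then show ?thesis by (simp add: sum_delta4 assms)
qed

lemma tensor_sharp_index:
  assumes B: "B \<in> carrier_mat n n" and rs: "r < n" "s < n"
  shows "tensor_sharp n T B $$ (r, s) = (\<Sum>j<n. \<Sum>k<n. T $$ (r * n + k, j * n + s) * B $$ (j, k))"
proof -
  have "tensor_sharp n T B $$ (r, s) = (\<Sum>i<n. \<Sum>j<n. \<Sum>k<n. \<Sum>l<n. T $$ (i * n + k, j * n + l) *
         (if i = r then if l = s then B $$ (j, k) else 0 else 0))"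
    unfolding tensor_sharp_def tensor_lift_def munit_sum_def using rs
    by (auto intro!: sum.cong simp: munit_mult_mult[OF B] simp del: index_mult_mat)
  also have "\<dots> = (\<Sum>i<n. if i = r then \<Sum>j<n. \<Sum>k<n. \<Sum>l<n. if l = s then T $$ (i * n + k, j * n + l) * B $$ (j, k) else 0 else 0)"
    by (intro sum.cong refl) (auto simp: mult_delta_right)
  finally show ?thesis using rs by simp
qed

lemma tensor_sharp_dim: "tensor_sharp n T B \<in> carrier_mat n n"
  by (simp add: tensor_sharp_def tensor_lift_def munit_sum_def)

lemma tensor_mult_eq_sharp: "tensor_mult n T = tensor_sharp n T (1\<^sub>m n)"
proof -
  have [simp]: "munit n n i j * 1\<^sub>m n = munit n n i j" for i j
    by (rule right_mult_one_mat) (auto simp: munit_def)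
  show ?thesis by (simp add: tensor_sharp_def tensor_mult_def tensor_lift_def munit_sum_def)
qed

lemma tensor_mult_index:
  assumes rs: "r < n" "s < n"
  shows "tensor_mult n T $$ (r, s) = (\<Sum>j<n. T $$ (r * n + j, j * n + s))"
proof -
  have "tensor_mult n T $$ (r, s) = (\<Sum>j<n. \<Sum>k<n. T $$ (r * n + k, j * n + s) * 1\<^sub>m n $$ (j, k))"
    unfolding tensor_mult_eq_sharp by (rule tensor_sharp_index[OF one_carrier_mat rs])
  also have "\<dots> = (\<Sum>j<n. \<Sum>k<n. if k = j then T $$ (r * n + k, j * n + s) else 0)"
    by (intro sum.cong refl) auto
  finally show ?thesis by simp
qed

lemma diff_quot_dim: "diff_quot \<Omega> f m n A B \<in> carrier_mat (m * n) (m * n)"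
  by (simp add: diff_quot_def munit_sum_def)

lemma diff_quot_index:
  assumes "power_summable R a" "eq_on_family (matricial_disc R) f (mat_series a)" "m \<ge> 1"
    "A \<in> matricial_disc R m" "B \<in> matricial_disc R n" "i < m" "j < m" "k < n" "l < n"
  shows "diff_quot (matricial_disc R) f m n A B $$ (i * n + k, j * n + l) = series_divdiff a A B i j k l"
  unfolding diff_quot_def munit_sum_kron_index[OF assms(6-9)]
  by (rule deriv_sim_ext_block[OF assms])

text \<open>The reindexing \<open>p \<mapsto> t - 1 - p\<close> exchanges the two tensor legs when both matrices agree.\<close>
lemma series_divdiff_flip: "series_divdiff a A A i j k l = series_divdiff a A A k l i j"
proof -
  have "(\<Sum>p<t. (A ^\<^sub>m p) $$ (i, j) * (A ^\<^sub>m (t - 1 - p)) $$ (k, l)) =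
      (\<Sum>p<t. (A ^\<^sub>m p) $$ (k, l) * (A ^\<^sub>m (t - 1 - p)) $$ (i, j))" for t
    by (subst sum.nat_diff_reindex[symmetric]) (auto intro!: sum.cong simp: mult.commute)
  then show ?thesis by (simp add: series_divdiff_def)
qed

lemma diff_quot_flip_invariant:
  assumes a: "power_summable R a" and f: "eq_on_family (matricial_disc R) f (mat_series a)"
    and n: "n \<ge> 1" and A: "A \<in> matricial_disc R n"
  shows "diff_quot (matricial_disc R) f n n A A = tensor_flip n n (diff_quot (matricial_disc R) f n n A A)"
proof (rule eq_matI)
  let ?T = "diff_quot (matricial_disc R) f n n A A"
  have d: "dim_row (tensor_flip n n ?T) = n * n" "dim_col (tensor_flip n n ?T) = n * n"
    by (auto simp: tensor_flip_def tensor_lift_def munit_sum_def)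
  show "dim_row ?T = dim_row (tensor_flip n n ?T)" "dim_col ?T = dim_col (tensor_flip n n ?T)"
    unfolding d by (simp_all add: carrier_matD[OF diff_quot_dim])
  fix r s assume "r < dim_row (tensor_flip n n ?T)" "s < dim_col (tensor_flip n n ?T)"
  then have "r < n * n" "s < n * n" using d by auto
  then have i: "r div n < n" "r mod n < n" "s div n < n" "s mod n < n"
    using n by (auto simp: less_mult_imp_div_less)
  have "?T $$ ((r div n) * n + r mod n, (s div n) * n + s mod n) =
      tensor_flip n n ?T $$ ((r div n) * n + r mod n, (s div n) * n + s mod n)"
    by (simp only: tensor_flip_index i diff_quot_index[OF a f n A A] series_divdiff_flip[of a A "r div n"])
  then show "?T $$ (r, s) = tensor_flip n n ?T $$ (r, s)" by simp
qed

lemma pow_mat_add: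
  assumes "A \<in> carrier_mat n n"
  shows "A ^\<^sub>m (p + q) = A ^\<^sub>m p * A ^\<^sub>m q"
proof (induction q)
  case 0
  then show ?case using assms by (simp add: right_mult_one_mat[of _ n n])
next
  case (Suc q)
  then show ?case using assms by (simp add: assoc_mult_mat[of _ n n _ n _ n])
qed

lemma sum_pow_entries_cyclic:
  assumes A: "(A :: complex mat) \<in> carrier_mat n n" and rs: "r < n" "s < n"
  shows "(\<Sum>j<n. \<Sum>p<t. (A ^\<^sub>m p) $$ (j, s) * (A ^\<^sub>m (t - 1 - p)) $$ (r, j)) =
    of_nat t * (A ^\<^sub>m (t - 1)) $$ (r, s)"
proof -
  have "(\<Sum>j<n. (A ^\<^sub>m p) $$ (j, s) * (A ^\<^sub>m (t - 1 - p)) $$ (r, j)) = (A ^\<^sub>m (t - 1)) $$ (r, s)"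
    if "p < t" for p
  proof -
    have "(\<Sum>j<n. (A ^\<^sub>m p) $$ (j, s) * (A ^\<^sub>m (t - 1 - p)) $$ (r, j)) = (A ^\<^sub>m (t - 1 - p) * A ^\<^sub>m p) $$ (r, s)"
      unfolding index_mult_mat_sum[OF pow_carrier_mat[OF A] pow_carrier_mat[OF A] rs]
      by (rule sum.cong[OF refl]) (rule mult.commute)
    also have "A ^\<^sub>m (t - 1 - p) * A ^\<^sub>m p = A ^\<^sub>m (t - 1)"
      using pow_mat_add[OF A, of "t - 1 - p" p] that by simp
    finally show ?thesis .
  qed
  then have "(\<Sum>p<t. \<Sum>j<n. (A ^\<^sub>m p) $$ (j, s) * (A ^\<^sub>m (t - 1 - p)) $$ (r, j)) =
      (\<Sum>p<t. (A ^\<^sub>m (t - 1)) $$ (r, s))"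
    by (intro sum.cong) auto
  then show ?thesis
    by (subst sum.swap) simp
qed

lemma sum_pow_entries_sharp:
  assumes A: "(A :: complex mat) \<in> carrier_mat n n" and rs: "r < n" "s < n"
  shows "(\<Sum>j<n. \<Sum>k<n. (\<Sum>p<t. (A ^\<^sub>m p) $$ (r, j) * (A ^\<^sub>m (t - 1 - p)) $$ (k, s)) * A $$ (j, k)) =
    of_nat t * (A ^\<^sub>m t) $$ (r, s)"
proof -
  have *: "(\<Sum>k<n. \<Sum>j<n. (A ^\<^sub>m p) $$ (r, j) * A $$ (j, k) * (A ^\<^sub>m (t - 1 - p)) $$ (k, s)) = (A ^\<^sub>m t) $$ (r, s)"
    if "p < t" for p
  proof -
    have "A ^\<^sub>m p * A * A ^\<^sub>m (t - 1 - p) = A ^\<^sub>m (Suc p + (t - 1 - p))"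
      unfolding pow_mat_add[OF A] by simp
    also have "Suc p + (t - 1 - p) = t" using that by simp
    finally show ?thesis
      using index_triple_mult_mat[OF pow_carrier_mat[OF A] A pow_carrier_mat[OF A] rs, of p "t - 1 - p"]
      by (simp add: sum_distrib_right)
  qed
  have "(\<Sum>j<n. \<Sum>k<n. (\<Sum>p<t. (A ^\<^sub>m p) $$ (r, j) * (A ^\<^sub>m (t - 1 - p)) $$ (k, s)) * A $$ (j, k)) =
      (\<Sum>j<n. \<Sum>k<n. \<Sum>p<t. (A ^\<^sub>m p) $$ (r, j) * A $$ (j, k) * (A ^\<^sub>m (t - 1 - p)) $$ (k, s))"
    unfolding sum_distrib_right by (intro sum.cong refl) (simp add: mult_ac)
  also have "\<dots> = (\<Sum>k<n. \<Sum>p<t. \<Sum>j<n. (A ^\<^sub>m p) $$ (r, j) * A $$ (j, k) * (A ^\<^sub>m (t - 1 - p)) $$ (k, s))"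
    by (subst sum.swap) (intro sum.cong refl sum.swap)
  also have "\<dots> = (\<Sum>p<t. \<Sum>k<n. \<Sum>j<n. (A ^\<^sub>m p) $$ (r, j) * A $$ (j, k) * (A ^\<^sub>m (t - 1 - p)) $$ (k, s))"
    by (rule sum.swap)
  also have "\<dots> = (\<Sum>p<t. (A ^\<^sub>m t) $$ (r, s))"
    by (intro sum.cong *) auto
  finally show ?thesis by simp
qed

text \<open>On power series the cyclic derivative is the ordinary derivative: each of the \<open>t\<close> terms
  \<open>A\<^sup>p \<otimes> A\<^sup>q\<close> with \<open>p + q = t - 1\<close> is mapped to \<open>A\<^sup>q A\<^sup>p\<close>.\<close>
lemma cyc_deriv_series:
  assumes a: "power_summable R a" and f: "eq_on_family (matricial_disc R) f (mat_series a)"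
    and n: "n \<ge> 1" and A: "A \<in> matricial_disc R n"
  shows "cyc_deriv (matricial_disc R) f n A = mat_series (diffs a) n A"
proof (rule eq_matI)
  have Ac: "A \<in> carrier_mat n n" using A by (auto simp: matricial_disc_def)
  show "dim_row (cyc_deriv (matricial_disc R) f n A) = dim_row (mat_series (diffs a) n A)"
    "dim_col (cyc_deriv (matricial_disc R) f n A) = dim_col (mat_series (diffs a) n A)"
    by (auto simp: cyc_deriv_def tensor_mult_def tensor_lift_def munit_sum_def)
  fix r s assume "r < dim_row (mat_series (diffs a) n A)" "s < dim_col (mat_series (diffs a) n A)"
  then have rs: "r < n" "s < n" by auto
  have "(\<lambda>t. \<Sum>j<n. a t * (\<Sum>p<t. (A ^\<^sub>m p) $$ (j, s) * (A ^\<^sub>m (t - 1 - p)) $$ (r, j)))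
      sums (\<Sum>j<n. series_divdiff a A A j s r j)"
    by (intro sums_sum series_divdiff_sums[OF a A A]) (use rs in auto)
  also have "(\<Sum>j<n. series_divdiff a A A j s r j) = cyc_deriv (matricial_disc R) f n A $$ (r, s)"
    unfolding cyc_deriv_def tensor_mult_index[OF rs]
    by (intro sum.cong refl) (simp add: tensor_flip_index diff_quot_index[OF a f n A A] rs)
  also have "(\<lambda>t. \<Sum>j<n. a t * (\<Sum>p<t. (A ^\<^sub>m p) $$ (j, s) * (A ^\<^sub>m (t - 1 - p)) $$ (r, j))) =
      (\<lambda>t. a t * (of_nat t * (A ^\<^sub>m (t - 1)) $$ (r, s)))"
    unfolding sum_pow_entries_cyclic[OF Ac rs, symmetric] sum_distrib_left ..
  finally have "(\<lambda>t. a (Suc t) * (of_nat (Suc t) * (A ^\<^sub>m t) $$ (r, s))) sums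
      cyc_deriv (matricial_disc R) f n A $$ (r, s)"
    using sums_Suc_iff[of "\<lambda>t. a t * (of_nat t * (A ^\<^sub>m (t - 1)) $$ (r, s))"] by simp
  then show "cyc_deriv (matricial_disc R) f n A $$ (r, s) = mat_series (diffs a) n A $$ (r, s)"
    using rs by (simp add: mat_series_def diffs_def sums_iff mult_ac)
qed

text \<open>Likewise each term \<open>A\<^sup>p \<otimes> A\<^sup>q\<close> is mapped to \<open>A\<^sup>p A A\<^sup>q\<close>, so the series of \<open>a\<close> goes to that of
  \<open>t a\<^sub>t\<close>.\<close>
lemma N_theta_series:
  assumes a: "power_summable R a" and f: "eq_on_family (matricial_disc R) f (mat_series a)"
    and n: "n \<ge> 1" and A: "A \<in> matricial_disc R n"
  shows "N_theta (matricial_disc R) f n A = mat_series (\<lambda>k. of_nat k * a k) n A"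
proof (rule eq_matI)
  have Ac: "A \<in> carrier_mat n n" using A by (auto simp: matricial_disc_def)
  show "dim_row (N_theta (matricial_disc R) f n A) = dim_row (mat_series (\<lambda>k. of_nat k * a k) n A)"
    "dim_col (N_theta (matricial_disc R) f n A) = dim_col (mat_series (\<lambda>k. of_nat k * a k) n A)"
    using tensor_sharp_dim by (auto simp: N_theta_def diff_quot_star_def)
  fix r s assume "r < dim_row (mat_series (\<lambda>k. of_nat k * a k) n A)"
    "s < dim_col (mat_series (\<lambda>k. of_nat k * a k) n A)"
  then have rs: "r < n" "s < n" by auto
  have "(\<lambda>t. \<Sum>j<n. \<Sum>k<n. a t * (\<Sum>p<t. (A ^\<^sub>m p) $$ (r, j) * (A ^\<^sub>m (t - 1 - p)) $$ (k, s)) * A $$ (j, k))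
      sums (\<Sum>j<n. \<Sum>k<n. series_divdiff a A A r j k s * A $$ (j, k))"
    by (intro sums_sum sums_mult2 series_divdiff_sums[OF a A A]) (use rs in auto)
  also have "(\<Sum>j<n. \<Sum>k<n. series_divdiff a A A r j k s * A $$ (j, k)) = N_theta (matricial_disc R) f n A $$ (r, s)"
    unfolding N_theta_def diff_quot_star_def z_theta_def tensor_sharp_index[OF Ac rs]
    by (intro sum.cong refl) (simp add: diff_quot_index[OF a f n A A] rs)
  also have "(\<lambda>t. \<Sum>j<n. \<Sum>k<n. a t * (\<Sum>p<t. (A ^\<^sub>m p) $$ (r, j) * (A ^\<^sub>m (t - 1 - p)) $$ (k, s)) * A $$ (j, k)) =
      (\<lambda>t. a t * (of_nat t * (A ^\<^sub>m t) $$ (r, s)))"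
    unfolding sum_pow_entries_sharp[OF Ac rs, symmetric] by (subst (1 2) sum_distrib_left) (simp only: mult.assoc)
  finally show "N_theta (matricial_disc R) f n A $$ (r, s) = mat_series (\<lambda>k. of_nat k * a k) n A $$ (r, s)"
    using rs by (simp add: mat_series_def sums_iff mult_ac)
qed

lemma mat_series_add:
  assumes a: "power_summable R a" and b: "power_summable R b" and A: "A \<in> matricial_disc R n"
  shows "mat_series a n A + mat_series b n A = mat_series (\<lambda>k. a k + b k) n A"
proof (rule eq_matI)
  fix i j assume "i < dim_row (mat_series (\<lambda>k. a k + b k) n A)" "j < dim_col (mat_series (\<lambda>k. a k + b k) n A)"
  then have ij: "i < n" "j < n" by auto
  have "(\<lambda>k. a k * (A ^\<^sub>m k) $$ (i, j) + b k * (A ^\<^sub>m k) $$ (i, j)) sums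
      (mat_series a n A $$ (i, j) + mat_series b n A $$ (i, j))"
    by (intro sums_add mat_series_sums[OF a A ij] mat_series_sums[OF b A ij])
  then show "(mat_series a n A + mat_series b n A) $$ (i, j) = mat_series (\<lambda>k. a k + b k) n A $$ (i, j)"
    using ij by (simp add: mat_series_def[of "\<lambda>k. a k + b k"] sums_iff algebra_simps)
qed auto

lemma mat_series_mult_right:
  assumes a: "power_summable R a" and A: "A \<in> matricial_disc R n"
  shows "mat_series a n A * A = mat_series (case_nat 0 a) n A"
proof (rule eq_matI)
  have Ac: "A \<in> carrier_mat n n" using A by (auto simp: matricial_disc_def)
  then show "dim_row (mat_series a n A * A) = dim_row (mat_series (case_nat 0 a) n A)"
    "dim_col (mat_series a n A * A) = dim_col (mat_series (case_nat 0 a) n A)" by auto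
  fix i j assume "i < dim_row (mat_series (case_nat 0 a) n A)" "j < dim_col (mat_series (case_nat 0 a) n A)"
  then have ij: "i < n" "j < n" by auto
  have "(\<lambda>k. \<Sum>x<n. a k * (A ^\<^sub>m k) $$ (i, x) * A $$ (x, j)) sums (\<Sum>x<n. mat_series a n A $$ (i, x) * A $$ (x, j))"
    by (intro sums_sum sums_mult2 mat_series_sums[OF a A]) (use ij in auto)
  also have "(\<Sum>x<n. mat_series a n A $$ (i, x) * A $$ (x, j)) = (mat_series a n A * A) $$ (i, j)"
    by (rule index_mult_mat_sum[symmetric]) (use Ac ij in auto)
  also have "(\<lambda>k. \<Sum>x<n. a k * (A ^\<^sub>m k) $$ (i, x) * A $$ (x, j)) = (\<lambda>k. case_nat 0 a (Suc k) * (A ^\<^sub>m Suc k) $$ (i, j))"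
  proof
    fix k
    have "(A ^\<^sub>m Suc k) $$ (i, j) = (\<Sum>x<n. (A ^\<^sub>m k) $$ (i, x) * A $$ (x, j))"
      unfolding pow_mat.simps by (rule index_mult_mat_sum[OF pow_carrier_mat[OF Ac] Ac ij])
    then show "(\<Sum>x<n. a k * (A ^\<^sub>m k) $$ (i, x) * A $$ (x, j)) = case_nat 0 a (Suc k) * (A ^\<^sub>m Suc k) $$ (i, j)"
      by (simp add: sum_distrib_left mult.assoc)
  qed
  finally have "(\<lambda>k. case_nat 0 a k * (A ^\<^sub>m k) $$ (i, j)) sums (mat_series a n A * A) $$ (i, j)"
    by (subst (asm) sums_Suc_iff) simp
  then show "(mat_series a n A * A) $$ (i, j) = mat_series (case_nat 0 a) n A $$ (i, j)"
    using ij by (simp add: mat_series_def[of "case_nat 0 a"] sums_iff)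
qed

section \<open>The equivalence\<close>

theorem theorem7p8:
  fixes R :: real and f :: mfun
  assumes "R > 0"
    and "f \<in> A_space (matricial_disc R)"
  shows "((\<exists>g \<in> A_space (matricial_disc R).
             eq_on_family (matricial_disc R) (cyc_deriv (matricial_disc R) g) f)
          \<longleftrightarrow>
          (\<forall>n\<ge>1. \<forall>\<omega> \<in> matricial_disc R n.
             diff_quot (matricial_disc R) f n n \<omega> \<omega> =
             tensor_flip n n (diff_quot (matricial_disc R) f n n \<omega> \<omega>)))
       \<and> ((\<forall>n\<ge>1. \<forall>\<omega> \<in> matricial_disc R n.
             diff_quot (matricial_disc R) f n n \<omega> \<omega> =
             tensor_flip n n (diff_quot (matricial_disc R) f n n \<omega> \<omega>))
          \<longleftrightarrow>
          eq_on_family (matricial_disc R)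
            (cyc_deriv (matricial_disc R) (cyc_deriv_star f))
            (L_theta (matricial_disc R) f))"
proof -
  obtain a where a: "power_summable R a" and f: "eq_on_family (matricial_disc R) f (mat_series a)"
    using A_space_eq_mat_series[OF assms(2)] by metis
  have "\<exists>g \<in> A_space (matricial_disc R). eq_on_family (matricial_disc R) (cyc_deriv (matricial_disc R) g) f"
  proof -
    \<comment> \<open>coefficients of the antiderivative\<close>
    define b where "b = case_nat 0 (\<lambda>k. a k / of_nat (Suc k))"
    have b: "power_summable R b"
    proof (rule power_summable_shift[OF a])
      show "cmod (b (Suc k)) \<le> cmod (a k)" for k
        using divide_left_mono[of 1 "real (Suc k)" "cmod (a k)"]
        by (simp add: b_def norm_divide del: of_nat_Suc)
    qed
    have "diffs b = a" by (auto simp: diffs_def b_def simp del: of_nat_Suc)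
    then have "eq_on_family (matricial_disc R) (cyc_deriv (matricial_disc R) (mat_series b)) f"
      using f cyc_deriv_series[OF b, of "mat_series b"] by (auto simp: eq_on_family_def)
    then show ?thesis using mat_series_in_A_space[OF b] by blast
  qed
  moreover have "\<forall>n\<ge>1. \<forall>\<omega> \<in> matricial_disc R n. diff_quot (matricial_disc R) f n n \<omega> \<omega> =
      tensor_flip n n (diff_quot (matricial_disc R) f n n \<omega> \<omega>)"
    using diff_quot_flip_invariant[OF a f] by blast
  moreover have "eq_on_family (matricial_disc R)
            (cyc_deriv (matricial_disc R) (cyc_deriv_star f)) (L_theta (matricial_disc R) f)"
    unfolding eq_on_family_def
  proof (intro allI impI ballI)
    fix n \<omega> assume n: "(1::nat) \<le> n" and \<omega>: "\<omega> \<in> matricial_disc R n"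
    \<comment> \<open>multiplication by the variable shifts the coefficients\<close>
    have b: "power_summable R (case_nat 0 a)" by (rule power_summable_shift[OF a]) simp
    have fb: "eq_on_family (matricial_disc R) (cyc_deriv_star f) (mat_series (case_nat 0 a))"
      using f mat_series_mult_right[OF a] by (auto simp: eq_on_family_def cyc_deriv_star_def z_theta_def)
    have "L_theta (matricial_disc R) f n \<omega> = mat_series (\<lambda>k. of_nat k * a k) n \<omega> + mat_series a n \<omega>"
      using f n \<omega> N_theta_series[OF a f n \<omega>] by (simp add: L_theta_def eq_on_family_def)
    also have "\<dots> = mat_series (\<lambda>k. of_nat k * a k + a k) n \<omega>"
      by (rule mat_series_add[OF power_summable_of_nat_mult[OF a] a \<omega>])
    also have "(\<lambda>k. of_nat k * a k + a k) = diffs (case_nat 0 a)"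
      by (auto simp: diffs_def algebra_simps)
    finally show "cyc_deriv (matricial_disc R) (cyc_deriv_star f) n \<omega> = L_theta (matricial_disc R) f n \<omega>"
      using cyc_deriv_series[OF b fb n \<omega>] by simp
  qed
  ultimately show ?thesis by blast
qed

end
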